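(* Let $\omega\in\mathcal{W}$ be given with associated weight matrix $\mathcal{M}_\omega=\{\mathbb{W}^{(\ell)}:\ell>0\}$ and let $0<\alpha\le1$. Then the following are equivalent: (a) The matrix $\mathcal{M}_\omega$ satisfies $(\mathcal{M}_{\{\mathrm{rai}\}})$. (b) $\omega$ satisfies condition $(\alpha_0)$: $\exists C\ge1\ \exists t_0\ge0\ \forall\lambda\ge1\ \forall t\ge t_0$: $\omega(\lambda t)\le C\lambda\omega(t)$. (c) The class $\mathcal{A}_{\{\omega\}}(S_\alpha)$ is holomorphically closed. (d) The class $\mathcal{A}_{\{\omega\}}(S_\alpha)$ is inverse-closed. If in addition $\omega(t)=O(t)$ as $t\to+\infty$, then (a)–(d) are also equivalent to each of: (e) The class $\mathcal{A}_{\{\omega\}}(S_\alpha)$ is closed under composition. (f) The matrix $\mathcal{M}_\omega$ satisfies $(\mathcal{M}_{\{\mathrm{FdB}\}})$.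
   Context: $\mathbb{N}_0=\{0,1,2,\dots\}$, $\mathbb{N}=\{1,2,\dots\}$. $\mathcal{W}_0$ is the set of continuous nondecreasing $\omega:[0,\infty)\to[0,\infty)$ with $\omega(t)=0$ for $t\in[0,1]$, $\lim_{t\to\infty}\omega(t)=\infty$, $\ln t=o(\omega(t))$ as $t\to\infty$, and $\varphi_\omega:t\mapsto\omega(e^t)$ convex on $\mathbb{R}$. $\mathcal{W}$ is the set of $\omega\in\mathcal{W}_0$ which also satisfy $\omega(2t)=O(\omega(t))$ as $t\to\infty$. For $\omega\in\mathcal{W}_0$, $\varphi^*_\omega(x):=\sup\{xy-\varphi_\omega(y):y\ge0\}$ for $x\ge0$, and the associated weight matrix is $\mathcal{M}_\omega=\{\mathbb{W}^{(\ell)}=(W^{(\ell)}_j)_{j\in\mathbb{N}_0}:\ell>0\}$ with $W^{(\ell)}_j:=\exp\left(\frac1\ell\varphi^*_\omega(\ell j)\right)$. Write $\check W^{(\ell)}_j:=W^{(\ell)}_j/j!$. - $(\mathcal{M}_{\{\mathrm{rai}\}})$ for $\mathcal{M}_\omega$: $\forall\ell>0\ \exists\ell'>0\ \exists H\ge1\ \forall1\le j\le k$: $(\check W^{(\ell)}_j)^{1/j}\le H(\check W^{(\ell')}_k)^{1/k}$. - $(\mathcal{M}_{\{\mathrm{FdB}\}})$ for $\mathcal{M}_\omega$: $\forall\ell>0\ \exists\ell'>0\ \exists A,B>0\ \forall k\in\mathbb{N}_0$: $(\check W^{(\ell)})^\circ_k\le AB^k\check W^{(\ell')}_k$, where for a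 sequence $\check{\mathbb{M}}$ one sets $\check M^\circ_0:=1$ and $\check M^\circ_k:=\max\{\check M_n\check M_{j_1}\cdots\check M_{j_n}:n\in\mathbb{N},\ j_i\in\mathbb{N},\ \sum_{i=1}^nj_i=k\}$ for $k\ge1$. $\mathcal{R}$ is the Riemann surface of the logarithm and $S_\alpha:=\{z\in\mathcal{R}:|\arg z|<\alpha\pi/2\}$; derivatives are with respect to the coordinate $z$; $\mathcal{H}(\cdot)$ denotes holomorphic functions. $\mathcal{A}_{\{\omega\}}(S)$ is the set of $f\in\mathcal{H}(S)$ for which there is $\ell>0$ with $\sup_{z\in S,j\in\mathbb{N}_0}\frac{|f^{(j)}(z)|}{\exp(\frac1\ell\varphi^*_\omega(\ell j))}<\infty$. For $\omega\in\mathcal{W}$ this equals $\mathcal{A}_{\{\mathcal{M}_\omega\}}(S)$, the set of $f\in\mathcal{H}(S)$ for which there are $\ell,h>0$ with $\sup_{z\in S,j\in\mathbb{N}_0}\frac{|f^{(j)}(z)|}{h^jW^{(\ell)}_j}<\infty$. For $U\subseteq\mathbb{C}$ open, $\mathcal{H}_{\{\mathcal{M}_\omega\}}(U)$ is the set of $g\in\mathcal{H}(U)$ such that for each compact $K\subset U$ there are $\ell,h>0$ with $\sup_{z\in K,j\in\mathbb{N}_0}\frac{|g^{(j)}(z)|}{h^jW^{(\ell)}_j}<\infty$. The class $\mathcal{A}:=\mathcal{A}_{\{\omega\}}(S_\alpha)$ is: holomorphically closed if $g\circ f\in\mathcal{A}$ for all $f\in\mathcal{A}$ and all $g\in\mathcal{H}(U)$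 with $U\subseteq\mathbb{C}$ open containing the closure of the range of $f$; inverse-closed if $1/f\in\mathcal{A}$ for all $f\in\mathcal{A}$ with $\inf_{z\in S_\alpha}|f(z)|>0$; closed under composition if $g\circ f\in\mathcal{A}$ for all $f\in\mathcal{A}$ and all $g\in\mathcal{H}_{\{\mathcal{M}_\omega\}}(U)$ with $U\subseteq\mathbb{C}$ open containing the closure of the range of $f$. *)

theory Defs
  imports
    "HOL-Complex_Analysis.Complex_Analysis"
    "HOL-Library.Landau_Symbols"
begin

section \<open>Weight functions\<close>

text \<open>A weight function on \<open>[0, \<infinity>)\<close> is a function \<open>real \<Rightarrow> real\<close>; its values at negative arguments
  are unconstrained and never used.\<close>

definition phi :: "(real \<Rightarrow> real) \<Rightarrow> real \<Rightarrow> real" where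
  "phi \<omega> = (\<lambda>t. \<omega> (exp t))"

definition weight_functions0 :: "(real \<Rightarrow> real) set" where
  "weight_functions0 = {\<omega>.
     continuous_on {0..} \<omega> \<and> mono_on {0..} \<omega> \<and> (\<forall>t\<ge>0. \<omega> t \<ge> 0) \<and>
     (\<forall>t\<in>{0..1}. \<omega> t = 0) \<and>
     filterlim \<omega> at_top at_top \<and>
     ln \<in> o[at_top](\<omega>) \<and>
     convex_on UNIV (phi \<omega>)}"

definition weight_functions :: "(real \<Rightarrow> real) set" where
  "weight_functions = {\<omega> \<in> weight_functions0. (\<lambda>t. \<omega> (2 * t)) \<in> O[at_top](\<omega>)}"

text \<open>For \<open>\<omega> \<in> weight_functions0\<close> and \<open>x \<ge> 0\<close> the supremum is over a set bounded above,
  because \<open>ln t = o(\<omega> t)\<close>.\<close>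

definition phi_star :: "(real \<Rightarrow> real) \<Rightarrow> real \<Rightarrow> real" where
  "phi_star \<omega> x = (SUP y\<in>{0..}. x * y - phi \<omega> y)"

definition alpha0 :: "(real \<Rightarrow> real) \<Rightarrow> bool" where
  "alpha0 \<omega> \<longleftrightarrow> (\<exists>C\<ge>1. \<exists>t0\<ge>0. \<forall>s\<ge>1. \<forall>t\<ge>t0. \<omega> (s * t) \<le> C * s * \<omega> t)"


section \<open>Weight matrices\<close>

text \<open>A weight matrix is a family of sequences \<open>M l\<close> indexed by the reals \<open>l > 0\<close>.\<close>

definition weight_matrix :: "(real \<Rightarrow> real) \<Rightarrow> real \<Rightarrow> nat \<Rightarrow> real" where
  "weight_matrix \<omega> l j = exp (1 / l * phi_star \<omega> (l * real j))"

definition check :: "(nat \<Rightarrow> real) \<Rightarrow> nat \<Rightarrow> real" where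
  "check M j = M j / fact j"

definition M_rai :: "(real \<Rightarrow> nat \<Rightarrow> real) \<Rightarrow> bool" where
  "M_rai M \<longleftrightarrow> (\<forall>l>0. \<exists>l'>0. \<exists>H\<ge>1. \<forall>j k. 1 \<le> j \<and> j \<le> k \<longrightarrow>
     check (M l) j powr (1 / real j) \<le> H * check (M l') k powr (1 / real k))"

text \<open>A tuple \<open>(j\<^sub>1, \<dots>, j\<^sub>n)\<close> is the list \<open>js\<close> with \<open>n = length js\<close>. For \<open>k \<ge> 1\<close> the set below
  is finite and nonempty.\<close>

definition circ :: "(nat \<Rightarrow> real) \<Rightarrow> nat \<Rightarrow> real" where
  "circ m k = (if k = 0 then 1 else
     Max {m (length js) * (\<Prod>j\<leftarrow>js. m j) | js.
       length js \<ge> 1 \<and> (\<forall>j\<in>set js. j \<ge> 1) \<and> sum_list js = k})"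

definition M_FdB :: "(real \<Rightarrow> nat \<Rightarrow> real) \<Rightarrow> bool" where
  "M_FdB M \<longleftrightarrow> (\<forall>l>0. \<exists>l'>0. \<exists>A>0. \<exists>B>0. \<forall>k.
     circ (check (M l)) k \<le> A * B ^ k * check (M l') k)"


section \<open>Function classes\<close>

text \<open>Sectors of opening \<open>\<alpha>\<pi>\<close>. For \<open>\<alpha> \<le> 2\<close> the sector in the Riemann surface of the logarithm
  lies in the principal sheet, which the coordinate \<open>z\<close> identifies with the slit plane; this
  definition is only meant for such \<open>\<alpha>\<close>. The condition \<open>z \<noteq> 0\<close> is needed as \<open>Arg 0 = 0\<close>.\<close>

definition sector :: "real \<Rightarrow> complex set" where
  "sector \<alpha> = {z. z \<noteq> 0 \<and> \<bar>Arg z\<bar> < \<alpha> * pi / 2}"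

text \<open>Functions on an open set are total functions whose values outside the set are irrelevant.
  Finiteness of a supremum of nonnegative reals is expressed as boundedness above.\<close>

definition ultraholomorphic :: "(real \<Rightarrow> real) \<Rightarrow> complex set \<Rightarrow> (complex \<Rightarrow> complex) set" where
  "ultraholomorphic \<omega> S = {f. f holomorphic_on S \<and>
     (\<exists>l>0. bdd_above {norm ((deriv ^^ j) f z) / exp (1 / l * phi_star \<omega> (l * real j)) | z j.
        z \<in> S})}"

definition local_class ::
  "(real \<Rightarrow> nat \<Rightarrow> real) \<Rightarrow> complex set \<Rightarrow> (complex \<Rightarrow> complex) set" where
  "local_class M U = {g. g holomorphic_on U \<and>
     (\<forall>K. compact K \<and> K \<subseteq> U \<longrightarrow>
       (\<exists>l>0. \<exists>h>0. bdd_above {norm ((deriv ^^ j) g z) / (h ^ j * M l j) | z j. z \<in> K}))}"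

definition holomorphically_closed :: "(real \<Rightarrow> real) \<Rightarrow> complex set \<Rightarrow> bool" where
  "holomorphically_closed \<omega> S \<longleftrightarrow>
     (\<forall>f\<in>ultraholomorphic \<omega> S. \<forall>U g. open U \<and> closure (f ` S) \<subseteq> U \<and> g holomorphic_on U \<longrightarrow>
        g \<circ> f \<in> ultraholomorphic \<omega> S)"

definition inverse_closed :: "(real \<Rightarrow> real) \<Rightarrow> complex set \<Rightarrow> bool" where
  "inverse_closed \<omega> S \<longleftrightarrow>
     (\<forall>f\<in>ultraholomorphic \<omega> S. (INF z\<in>S. norm (f z)) > 0 \<longrightarrow>
        (\<lambda>z. 1 / f z) \<in> ultraholomorphic \<omega> S)"

definition composition_closed :: "(real \<Rightarrow> real) \<Rightarrow> complex set \<Rightarrow> bool" where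
  "composition_closed \<omega> S \<longleftrightarrow>
     (\<forall>f\<in>ultraholomorphic \<omega> S. \<forall>U. open U \<and> closure (f ` S) \<subseteq> U \<longrightarrow>
        (\<forall>g\<in>local_class (weight_matrix \<omega>) U. g \<circ> f \<in> ultraholomorphic \<omega> S))"

end

theory Submission
  imports Defs
begin

text \<open>
  The conditions \<open>M_rai\<close> and \<open>alpha0\<close> are compared through the Legendre transform: up to constants,
  \<open>M_rai\<close> says that \<open>phi_star \<omega> (l j) / (l j) + ln (k / j) \<le> phi_star \<omega> (l' k) / (l' k)\<close> for \<open>j \<le> k\<close>,
  which is dual to \<open>phi \<omega> (y + s) \<le> C exp s phi \<omega> y\<close>.

  Under \<open>M_rai\<close> the Taylor coefficients of a function in the class are, up to order \<open>k\<close>, dominated by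
  a geometric sequence whose \<open>k\<close>-th term is admissible. Powers of a geometric series are
  explicit, so the Taylor series of a composite can be estimated term by term, and holomorphic
  outer functions are covered because \<open>M_rai\<close> forces \<open>k! \<le> H\<^sup>k W l k\<close>.

  Conversely, inverse-closedness is applied to \<open>3 - f\<close>, where \<open>f\<close> is a superposition of decaying
  exponentials (bounded because \<open>\<alpha> \<le> 1\<close>) whose derivatives have maximal size and alternating
  signs. After the reflection \<open>x \<mapsto> -x\<close> the coefficients of \<open>1 / (3 - f)\<close> are sums of nonnegative
  terms, one of which is the \<open>m\<close>-th power of the \<open>j\<close>-th coefficient of \<open>f\<close>. This bounds
  \<open>(W l j / j!)\<^sup>m\<close> by \<open>D\<^sup>j\<^sup>m W l' (j m) / (j m)!\<close>, which is \<open>M_rai\<close> along multiples of \<open>j\<close>.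
  If \<open>\<omega>(t) = O(t)\<close>, then \<open>M_FdB\<close> yields the same bound by choosing all \<open>j\<^sub>i = j\<close>.
\<close>

section \<open>The Legendre transform and the weight matrix\<close>

locale weight_function =
  fixes \<omega> :: "real \<Rightarrow> real"
  assumes weight: "\<omega> \<in> weight_functions"
begin

abbreviation "W \<equiv> weight_matrix \<omega>"
abbreviation "V l \<equiv> check (W l)"

section \<open>The weight function on the logarithmic scale\<close>

lemma phi_nonneg: "phi \<omega> y \<ge> 0"
  using weight unfolding weight_functions_def weight_functions0_def phi_def by auto

lemma phi_eq_0: "y \<le> 0 \<Longrightarrow> phi \<omega> y = 0"
  using weight unfolding weight_functions_def weight_functions0_def phi_def by auto

lemma phi_mono: "x \<le> y \<Longrightarrow> phi \<omega> x \<le> phi \<omega> y"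
  using weight unfolding weight_functions_def weight_functions0_def phi_def
  by (auto simp: monotone_on_def)

lemma phi_convex: "convex_on UNIV (phi \<omega>)"
  using weight unfolding weight_functions_def weight_functions0_def by auto

text \<open>The condition \<open>ln t = o(\<omega> t)\<close> at \<open>t = exp y\<close>. It keeps
  the supremum in \<open>phi_star\<close> finite.\<close>

lemma phi_superlinear:
  assumes "c > 0"
  obtains T where "T \<ge> 0" "\<And>y. y \<ge> T \<Longrightarrow> c * y \<le> phi \<omega> y"
proof -
  have "ln \<in> o[at_top](\<omega>)"
    using weight unfolding weight_functions_def weight_functions0_def by auto
  from landau_o.smallD[OF this, of "1 / c"] assms
  obtain N where N: "\<And>t. t \<ge> N \<Longrightarrow> \<bar>ln t\<bar> \<le> 1 / c * \<bar>\<omega> t\<bar>"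
    by (auto simp: eventually_at_top_linorder)
  have "c * y \<le> phi \<omega> y" if "y \<ge> max 0 N" for y
  proof -
    have "exp y \<ge> N" using that exp_ge_add_one_self[of y] by linarith
    from N[OF this] have "c * \<bar>y\<bar> \<le> \<bar>phi \<omega> y\<bar>"
      using assms by (simp add: phi_def field_simps)
    then show ?thesis using phi_nonneg[of y] that by simp
  qed
  then show thesis using that[of "max 0 N"] by simp
qed

text \<open>Doubling the argument becomes a shift by \<open>ln 2\<close>. The added 1 covers a
  bounded range of \<open>y\<close>, where \<open>phi \<omega>\<close> may vanish and the asymptotic
  bound says nothing.\<close>

lemma phi_shift_one:
  obtains L where "L \<ge> 1" "\<And>y. y \<ge> 0 \<Longrightarrow> phi \<omega> (y + ln 2) \<le> L * (phi \<omega> y + 1)"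
proof -
  have "(\<lambda>t. \<omega> (2 * t)) \<in> O[at_top](\<omega>)"
    using weight unfolding weight_functions_def by auto
  then obtain c where c: "c > 0" "eventually (\<lambda>t. norm (\<omega> (2 * t)) \<le> c * norm (\<omega> t)) at_top"
    using landau_o.bigE by blast
  from c(2) obtain N where N: "\<And>t. t \<ge> N \<Longrightarrow> \<bar>\<omega> (2 * t)\<bar> \<le> c * \<bar>\<omega> t\<bar>"
    by (auto simp: eventually_at_top_linorder)
  define M where "M = max N 0"
  define L where "L = max 1 (max c (phi \<omega> (M + ln 2)))"
  have "phi \<omega> (y + ln 2) \<le> L * (phi \<omega> y + 1)" if "y \<ge> 0" for y
  proof (cases "y \<ge> M")
    case True
    have "exp y \<ge> N" using True exp_ge_add_one_self[of y] unfolding M_def by linarith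
    from N[OF this] have "\<bar>phi \<omega> (y + ln 2)\<bar> \<le> c * \<bar>phi \<omega> y\<bar>"
      by (simp add: phi_def exp_add mult.commute)
    then have "phi \<omega> (y + ln 2) \<le> c * phi \<omega> y"
      using phi_nonneg[of y] phi_nonneg[of "y + ln 2"] by simp
    also have "\<dots> \<le> L * phi \<omega> y"
      using phi_nonneg by (intro mult_right_mono) (auto simp: L_def)
    also have "\<dots> \<le> L * (phi \<omega> y + 1)" by (auto simp: L_def algebra_simps)
    finally show ?thesis .
  next
    case False
    have "phi \<omega> (y + ln 2) \<le> phi \<omega> (M + ln 2)" using False by (intro phi_mono) auto
    also have "\<dots> \<le> L" by (auto simp: L_def)
    also have "\<dots> \<le> L * (phi \<omega> y + 1)"
      using phi_nonneg[of y] by (auto simp: L_def algebra_simps)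
    finally show ?thesis .
  qed
  then show thesis using that[of L] by (auto simp: L_def)
qed

lemma phi_shift:
  obtains L where "L \<ge> 1" "\<And>y. y \<ge> 0 \<Longrightarrow> phi \<omega> (y + s) \<le> L * (phi \<omega> y + 1)"
proof -
  obtain K where K: "K \<ge> 1" "\<And>y. y \<ge> 0 \<Longrightarrow> phi \<omega> (y + ln 2) \<le> K * (phi \<omega> y + 1)"
    using phi_shift_one by blast
  have nat_shift: "\<exists>L\<ge>1. \<forall>y\<ge>0. phi \<omega> (y + real n * ln 2) \<le> L * (phi \<omega> y + 1)" for n
  proof (induction n)
    case 0
    show ?case by (intro exI[of _ 1]) auto
  next
    case (Suc n)
    then obtain L where L: "L \<ge> 1" "\<forall>y\<ge>0. phi \<omega> (y + real n * ln 2) \<le> L * (phi \<omega> y + 1)"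
      by blast
    \<comment> \<open>Since \<open>1 \<le> K * (phi \<omega> y + 1)\<close>, the additive 1 of each
      iteration is absorbed by the factor 2.\<close>
    have "phi \<omega> (y + real (Suc n) * ln 2) \<le> 2 * L * K * (phi \<omega> y + 1)" if "y \<ge> 0" for y
    proof -
      have "phi \<omega> (y + real (Suc n) * ln 2) = phi \<omega> ((y + ln 2) + real n * ln 2)"
        by (simp add: algebra_simps)
      also have "\<dots> \<le> L * (phi \<omega> (y + ln 2) + 1)"
        using L(2) that by auto
      also have "\<dots> \<le> L * (K * (phi \<omega> y + 1) + K * (phi \<omega> y + 1))"
      proof -
        have "1 * 1 \<le> K * (phi \<omega> y + 1)" using K(1) phi_nonneg[of y] by (intro mult_mono) auto
        then show ?thesis using K(2)[OF that] L(1) by (intro mult_left_mono add_mono) auto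
      qed
      finally show ?thesis by (simp add: algebra_simps)
    qed
    moreover have "1 * 1 * 1 \<le> 2 * L * K" using L(1) K(1) by (intro mult_mono) auto
    ultimately show ?case by (intro exI[of _ "2 * L * K"]) auto
  qed
  obtain n where n: "s / ln 2 \<le> real n" using real_arch_simple by blast
  obtain L where L: "L \<ge> 1" "\<forall>y\<ge>0. phi \<omega> (y + real n * ln 2) \<le> L * (phi \<omega> y + 1)"
    using nat_shift by blast
  have "phi \<omega> (y + s) \<le> L * (phi \<omega> y + 1)" if "y \<ge> 0" for y
  proof -
    have "phi \<omega> (y + s) \<le> phi \<omega> (y + real n * ln 2)"
      using n by (intro phi_mono) (auto simp: field_simps)
    also have "\<dots> \<le> L * (phi \<omega> y + 1)" using L(2) that by auto
    finally show ?thesis .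
  qed
  then show thesis using that[of L] L(1) by auto
qed

section \<open>The Legendre conjugate\<close>

lemma phi_star_bdd: "bdd_above ((\<lambda>y. x * y - phi \<omega> y) ` {0..})"
proof -
  obtain T where T: "T \<ge> 0" "\<And>y. y \<ge> T \<Longrightarrow> (\<bar>x\<bar> + 1) * y \<le> phi \<omega> y"
    using phi_superlinear[of "\<bar>x\<bar> + 1"] by (metis abs_ge_zero add_nonneg_pos zero_less_one)
  \<comment> \<open>Beyond \<open>T\<close> superlinear growth makes the expression nonpositive;
    before \<open>T\<close> it is at most \<open>\<bar>x\<bar> * T\<close>.\<close>
  have "x * y - phi \<omega> y \<le> \<bar>x\<bar> * T" if "y \<ge> 0" for y
  proof (cases "y \<ge> T")
    case True
    have "x * y \<le> (\<bar>x\<bar> + 1) * y" using that by (intro mult_right_mono) auto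
    moreover have "0 \<le> \<bar>x\<bar> * T" using T(1) by simp
    ultimately show ?thesis using T(2)[OF True] by linarith
  next
    case False
    have "x * y \<le> \<bar>x\<bar> * T" using that False by (intro mult_mono) auto
    then show ?thesis using phi_nonneg[of y] by linarith
  qed
  then show ?thesis by (auto simp: bdd_above_def)
qed

lemma phi_star_ge: "y \<ge> 0 \<Longrightarrow> x * y - phi \<omega> y \<le> phi_star \<omega> x"
  unfolding phi_star_def by (rule cSUP_upper[OF _ phi_star_bdd]) auto

lemma phi_star_le: "(\<And>y. y \<ge> 0 \<Longrightarrow> x * y - phi \<omega> y \<le> B) \<Longrightarrow> phi_star \<omega> x \<le> B"
  unfolding phi_star_def by (rule cSUP_least) auto

lemma phi_star_nonneg: "phi_star \<omega> x \<ge> 0"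
  using phi_star_ge[of 0 x] phi_eq_0[of 0] by simp

lemma phi_star_0: "phi_star \<omega> 0 = 0"
  using phi_star_le[of 0 0] phi_star_nonneg[of 0] phi_nonneg by force

lemma phi_star_convex:
  assumes "0 \<le> t" "t \<le> 1"
  shows "phi_star \<omega> ((1 - t) * x + t * y) \<le> (1 - t) * phi_star \<omega> x + t * phi_star \<omega> y"
proof (rule phi_star_le)
  fix u :: real
  assume u: "u \<ge> 0"
  have "((1 - t) * x + t * y) * u - phi \<omega> u = (1 - t) * (x * u - phi \<omega> u) + t * (y * u - phi \<omega> u)"
    by (simp add: algebra_simps)
  also have "\<dots> \<le> (1 - t) * phi_star \<omega> x + t * phi_star \<omega> y"
    using assms phi_star_ge[OF u] by (intro add_mono mult_left_mono) auto
  finally show "((1 - t) * x + t * y) * u - phi \<omega> u \<le> (1 - t) * phi_star \<omega> x + t * phi_star \<omega> y" .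
qed

text \<open>Convexity and \<open>phi_star \<omega> 0 = 0\<close>. This makes the sequences increase
  with the parameter and \<open>Q\<close> increase with the index.\<close>

lemma phi_star_scale: "0 \<le> t \<Longrightarrow> t \<le> 1 \<Longrightarrow> phi_star \<omega> (t * x) \<le> t * phi_star \<omega> x"
  using phi_star_convex[of t 0 x] by (simp add: phi_star_0)

lemma phi_star_quot_mono:
  assumes "0 < x" "x \<le> y"
  shows "phi_star \<omega> x / x \<le> phi_star \<omega> y / y"
  using phi_star_scale[of "x / y" y] assms by (simp add: field_simps)

text \<open>Biconjugation: \<open>x\<close> is the slope of a supporting line of \<open>phi \<omega>\<close> at \<open>y\<close>.\<close>

lemma phi_attained:
  obtains x where "x \<ge> 0" "phi \<omega> y \<le> x * y - phi_star \<omega> x"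
proof -
  define x where "x = Inf ((\<lambda>t. (phi \<omega> y - phi \<omega> t) / (y - t)) ` ({y<..} \<inter> UNIV))"
  have line: "phi \<omega> y + x * (u - y) \<le> phi \<omega> u" for u
    unfolding x_def using convex_le_Inf_differential[OF phi_convex] by simp
  have "x \<ge> 0"
    using line[of "y - 1"] phi_mono[of "y - 1" y] by simp
  moreover have "phi_star \<omega> x \<le> x * y - phi \<omega> y"
  proof (rule phi_star_le)
    fix u :: real
    show "x * u - phi \<omega> u \<le> x * y - phi \<omega> y" using line[of u] by (simp add: algebra_simps)
  qed
  ultimately show thesis using that[of x] by simp
qed

section \<open>The weight sequences\<close>

lemma W_pos: "W l j > 0"
  by (simp add: weight_matrix_def)

lemma V_pos: "V l j > 0"
  by (simp add: check_def W_pos)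

lemma W_0: "W l 0 = 1"
  by (simp add: weight_matrix_def phi_star_0)

lemma V_0: "V l 0 = 1"
  by (simp add: check_def W_0)

lemma W_ge_1: "l > 0 \<Longrightarrow> W l j \<ge> 1"
  by (simp add: weight_matrix_def phi_star_nonneg)

lemma W_mono:
  assumes "0 < l" "l \<le> l'"
  shows "W l j \<le> W l' j"
proof -
  have "phi_star \<omega> (l * real j) \<le> l / l' * phi_star \<omega> (l' * real j)"
    using phi_star_scale[of "l / l'" "l' * real j"] assms by simp
  then show ?thesis using assms by (simp add: weight_matrix_def field_simps)
qed

lemma V_mono: "0 < l \<Longrightarrow> l \<le> l' \<Longrightarrow> V l j \<le> V l' j"
  using W_mono by (simp add: check_def divide_right_mono)

lemma W_log_convex:
  assumes "l > 0"
  shows "W l (Suc j) * W l (Suc j) \<le> W l j * W l (Suc (Suc j))"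
proof -
  have "l * real (Suc j) = (1 - 1/2) * (l * real j) + 1/2 * (l * real (Suc (Suc j)))"
    by (simp add: field_simps)
  then have "phi_star \<omega> (l * real (Suc j)) \<le>
      1/2 * phi_star \<omega> (l * real j) + 1/2 * phi_star \<omega> (l * real (Suc (Suc j)))"
    using phi_star_convex[of "1/2" "l * real j" "l * real (Suc (Suc j))"] by simp
  then have "1 / l * (2 * phi_star \<omega> (l * real (Suc j))) \<le>
      1 / l * (phi_star \<omega> (l * real j) + phi_star \<omega> (l * real (Suc (Suc j))))"
    using assms by (intro mult_left_mono) auto
  then show ?thesis
    by (simp only: weight_matrix_def exp_add[symmetric] exp_le_cancel_iff) (simp add: algebra_simps)
qed

text \<open>\<open>l * (j + k)\<close> is the midpoint of \<open>2 * l * j\<close> and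
  \<open>2 * l * k\<close>: moderate growth holds at the price of doubling the parameter.\<close>

lemma W_add:
  assumes "l > 0"
  shows "W l (j + k) \<le> W (2 * l) j * W (2 * l) k"
  using phi_star_convex[of "1/2" "2 * l * real j" "2 * l * real k"] assms
  by (simp add: weight_matrix_def flip: exp_add) (simp add: field_simps)

text \<open>The doubling condition on \<open>\<omega>\<close> lets the matrix absorb geometric factors.\<close>

lemma W_absorb:
  assumes "l > 0"
  obtains l' A where "l' > 0" "A > 0" "\<And>j. B ^ j * W l j \<le> A * W l' j"
proof -
  define s where "s = ln (max 1 \<bar>B\<bar>)"
  have s: "s \<ge> 0" by (auto simp: s_def)
  obtain L where L: "L \<ge> 1" "\<And>y. y \<ge> 0 \<Longrightarrow> phi \<omega> (y + s) \<le> L * (phi \<omega> y + 1)"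
    using phi_shift by blast
  \<comment> \<open>Testing \<open>phi_star\<close> at \<open>y + s\<close> rather than
    \<open>y\<close> gains \<open>s\<close> per index; by \<open>phi_shift\<close> this costs the
    factor \<open>L\<close> in the parameter.\<close>
  have main: "1 / l * phi_star \<omega> (l * real j) + real j * s \<le> 1 / l + 1 / (L * l) * phi_star \<omega> (L * l * real j)"
    for j
  proof -
    have "phi_star \<omega> (l * real j) \<le> l * (1 / l + 1 / (L * l) * phi_star \<omega> (L * l * real j) - real j * s)"
    proof (rule phi_star_le)
      fix y :: real
      assume y: "y \<ge> 0"
      have "L * l * real j * (y + s) - L * (phi \<omega> y + 1) \<le> phi_star \<omega> (L * l * real j)"
        using phi_star_ge[of "y + s" "L * l * real j"] L(2)[OF y] y s by linarith
      then have "(L * l * real j * (y + s) - L * (phi \<omega> y + 1)) / L \<le> phi_star \<omega> (L * l * real j) / L"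
        using L(1) by (intro divide_right_mono) auto
      then have "l * real j * (y + s) - (phi \<omega> y + 1) \<le> phi_star \<omega> (L * l * real j) / L"
        using L(1) by (simp add: diff_divide_distrib)
      then show "l * real j * y - phi \<omega> y \<le> l * (1 / l + 1 / (L * l) * phi_star \<omega> (L * l * real j) - real j * s)"
        using assms L(1) by (simp add: algebra_simps)
    qed
    then show ?thesis using assms by (simp add: field_simps)
  qed
  show thesis
  proof (rule that)
    show "L * l > 0" using L(1) assms by simp
    show "exp (1 / l) > 0" by simp
    show "B ^ j * W l j \<le> exp (1 / l) * W (L * l) j" for j
    proof -
      have "B ^ j \<le> \<bar>B\<bar> ^ j" by (simp flip: power_abs)
      also have "\<dots> \<le> max 1 \<bar>B\<bar> ^ j" by (intro power_mono) auto
      also have "\<dots> = exp (real j * s)" by (simp add: s_def exp_of_nat_mult)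
      finally have "B ^ j * W l j \<le> exp (real j * s) * W l j"
        using W_pos by (intro mult_right_mono) (auto intro: less_imp_le)
      also have "\<dots> \<le> exp (1 / l) * W (L * l) j"
        using main[of j] by (simp add: weight_matrix_def add.commute flip: exp_add)
      finally show ?thesis .
    qed
  qed
qed

end

section \<open>Growth conditions\<close>

lemma ln_fact_le: "ln (fact j) \<le> real j * ln (real j)"
proof (cases "j = 0")
  case False
  have "ln (fact j :: real) \<le> ln (real j ^ j)"
    using fact_le_power[of j, where ?'a = real] False by (intro ln_mono) auto
  then show ?thesis using False by (simp add: ln_realpow)
qed simp

lemma ln_fact_ge: "real j * (ln (real j) - 1) \<le> ln (fact j)"
proof (cases "j = 0")
  case False
  \<comment> \<open>A single term of the exponential series at \<open>j\<close> gives
    \<open>j^j / j! \<le> e^j\<close>.\<close>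
  have "real j ^ j /\<^sub>R fact j \<le> exp (real j)"
    unfolding exp_def
    using sum_le_suminf[OF summable_exp_generic[of "real j"], of "{j}"] by simp
  then have "ln (real j ^ j / fact j) \<le> ln (exp (real j))"
    using False by (intro ln_mono) (auto simp: divide_inverse mult.commute)
  then show ?thesis using False by (simp add: ln_realpow ln_div algebra_simps)
qed simp

context weight_function
begin

text \<open>\<open>Q l j\<close> is the logarithm of the \<open>j\<close>-th root of \<open>W l j\<close>.\<close>

definition Q :: "real \<Rightarrow> nat \<Rightarrow> real" where
  "Q l j = phi_star \<omega> (l * real j) / (l * real j)"

lemma Q_nonneg: "l > 0 \<Longrightarrow> Q l j \<ge> 0"
  by (simp add: Q_def phi_star_nonneg)

lemma Q_mono: "l > 0 \<Longrightarrow> 1 \<le> j \<Longrightarrow> j \<le> k \<Longrightarrow> Q l j \<le> Q l k"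
  unfolding Q_def by (intro phi_star_quot_mono) auto

lemma ln_V: "l > 0 \<Longrightarrow> j \<ge> 1 \<Longrightarrow> ln (V l j) = real j * Q l j - ln (fact j)"
  using W_pos[of l j] by (simp add: check_def ln_div) (simp add: weight_matrix_def Q_def)

lemma V_powr:
  assumes "l > 0" "j \<ge> 1"
  shows "V l j powr (1 / real j) = exp (Q l j - ln (fact j) / real j)"
proof -
  have "V l j powr (1 / real j) = exp (1 / real j * ln (V l j))"
    using V_pos[of l j] by (simp add: powr_def)
  then show ?thesis using assms by (simp add: ln_V diff_divide_distrib)
qed

text \<open>The factorials enter \<open>M_rai\<close> only through Stirling's estimate \<open>j! \<approx> (j/e)\<^sup>j\<close>.\<close>

lemma M_rai_iff:
  "M_rai W \<longleftrightarrow> (\<forall>l>0. \<exists>l'>0. \<exists>h\<ge>0. \<forall>j k. 1 \<le> j \<longrightarrow> j \<le> k \<longrightarrow>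
     Q l j + ln (real k / real j) \<le> h + Q l' k)" (is "?L \<longleftrightarrow> ?R")
proof -
  have step: "V l j powr (1 / real j) \<le> exp h * V l' k powr (1 / real k) \<longleftrightarrow>
      Q l j - ln (fact j) / real j \<le> h + (Q l' k - ln (fact k) / real k)"
    if "l > 0" "l' > 0" "1 \<le> j" "j \<le> k" for l l' h j k
    using that V_powr[of l j] V_powr[of l' k] by (simp flip: exp_add)
  have stirling: "ln (fact j) / real j \<le> ln (real j)" "ln (real j) - 1 \<le> ln (fact j) / real j"
    if "1 \<le> j" for j
    using ln_fact_le[of j] ln_fact_ge[of j] that by (simp_all add: field_simps)
  show ?thesis
  proof
    assume L: ?L
    show ?R
    proof (intro allI impI)
      fix l :: real
      assume "l > 0"
      then obtain l' H where l': "l' > 0" "H \<ge> 1"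
        "\<forall>j k. 1 \<le> j \<and> j \<le> k \<longrightarrow> V l j powr (1 / real j) \<le> H * V l' k powr (1 / real k)"
        using L unfolding M_rai_def by blast
      \<comment> \<open>The upper Stirling bound is used at \<open>j\<close> and the lower one at
        \<open>k\<close>; only the latter loses the added 1.\<close>
      have "Q l j + ln (real k / real j) \<le> (ln H + 1) + Q l' k" if "1 \<le> j" "j \<le> k" for j k
      proof -
        have "Q l j - ln (fact j) / real j \<le> ln H + (Q l' k - ln (fact k) / real k)"
          using step[of l l' j k "ln H"] that l' \<open>l > 0\<close> by simp
        then show ?thesis
          using stirling[of j] stirling[of k] that by (simp add: ln_div)
      qed
      then show "\<exists>l'>0. \<exists>h\<ge>0. \<forall>j k. 1 \<le> j \<longrightarrow> j \<le> k \<longrightarrow> Q l j + ln (real k / real j) \<le> h + Q l' k"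
        using l' by (intro exI[of _ l'] conjI exI[of _ "ln H + 1"]) auto
    qed
  next
    assume R: ?R
    show ?L
      unfolding M_rai_def
    proof (intro allI impI)
      fix l :: real
      assume "l > 0"
      then obtain l' h where l': "l' > 0" "h \<ge> 0"
        "\<forall>j k. 1 \<le> j \<longrightarrow> j \<le> k \<longrightarrow> Q l j + ln (real k / real j) \<le> h + Q l' k"
        using R by blast
      have "V l j powr (1 / real j) \<le> exp (h + 1) * V l' k powr (1 / real k)" if "1 \<le> j \<and> j \<le> k" for j k
      proof -
        have "Q l j + ln (real k / real j) \<le> h + Q l' k" using l' that by auto
        then have "Q l j - ln (fact j) / real j \<le> (h + 1) + (Q l' k - ln (fact k) / real k)"
          using stirling[of j] stirling[of k] that by (simp add: ln_div)
        then show ?thesis using step[of l l' j k "h + 1"] that l' \<open>l > 0\<close> by simp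
      qed
      then show "\<exists>l'>0. \<exists>H\<ge>1. \<forall>j k. 1 \<le> j \<and> j \<le> k \<longrightarrow>
          V l j powr (1 / real j) \<le> H * V l' k powr (1 / real k)"
        using l' by (intro exI[of _ l'] conjI exI[of _ "exp (h + 1)"]) auto
    qed
  qed
qed

text \<open>Test \<open>phi_star\<close> with slope \<open>C * l * k\<close> at
  \<open>y + s\<close>, where \<open>exp s = k / j\<close>. After division by the slope,
  \<open>alpha0\<close> turns the penalty into \<open>phi \<omega> y / (l * j)\<close>, and the
  supremum of \<open>y\<close> minus this penalty is \<open>Q l j\<close>.\<close>

lemma alpha0_imp_M_rai:
  assumes "alpha0 \<omega>"
  shows "M_rai W"
  unfolding M_rai_iff
proof (intro allI impI)
  fix l :: real
  assume l: "l > 0"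
  obtain C t0 where C: "C \<ge> 1" "t0 \<ge> 0" "\<And>s t. s \<ge> 1 \<Longrightarrow> t \<ge> t0 \<Longrightarrow> \<omega> (s * t) \<le> C * s * \<omega> t"
    using assms unfolding alpha0_def by blast
  define y0 where "y0 = ln (max 1 t0)"
  have y0: "y0 \<ge> 0" by (simp add: y0_def)
  \<comment> \<open>For \<open>y < y0\<close>, where \<open>alpha0\<close> gives nothing, the value
    is compared with that at \<open>y0\<close>; as \<open>x \<ge> l\<close>, the loss
    \<open>phi \<omega> y0 / x\<close> is bounded uniformly in \<open>j\<close>.\<close>
  define h where "h = phi \<omega> y0 / l"
  have h: "h \<ge> 0" using l phi_nonneg by (simp add: h_def)
  have "Q l j + ln (real k / real j) \<le> h + Q (C * l) k" if jk: "1 \<le> j" "j \<le> k" for j k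
  proof -
    define s where "s = ln (real k / real j)"
    have s: "s \<ge> 0" "exp s = real k / real j" using jk by (auto simp: s_def)
    define x where "x = l * real j"
    have x: "x > 0" "x \<ge> l" using jk l by (auto simp: x_def)
    have key: "y + s - phi \<omega> y / x \<le> Q (C * l) k" if y: "y \<ge> y0" for y
    proof -
      have "exp y \<ge> t0"
        using exp_le_cancel_iff[of y0 y] y by (simp add: y0_def)
      then have "phi \<omega> (y + s) \<le> C * exp s * phi \<omega> y"
        using C(3)[of "exp s" "exp y"] s(1) by (simp add: phi_def exp_add mult.commute)
      then have "C * l * real k * (y + s) - C * exp s * phi \<omega> y \<le> phi_star \<omega> (C * l * real k)"
        using phi_star_ge[of "y + s" "C * l * real k"] y y0 s by linarith
      then have "(C * l * real k * (y + s) - C * exp s * phi \<omega> y) / (C * l * real k) \<le> Q (C * l) k"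
        unfolding Q_def using C l by (intro divide_right_mono) auto
      moreover have "(C * l * real k * (y + s) - C * exp s * phi \<omega> y) / (C * l * real k)
          = y + s - phi \<omega> y / x"
        using C l jk by (simp add: s x_def field_simps)
      ultimately show ?thesis by simp
    qed
    have h_le: "phi \<omega> y0 / x \<le> h"
      unfolding h_def using x l phi_nonneg by (intro divide_left_mono) auto
    have "phi_star \<omega> x \<le> x * (h + Q (C * l) k - s)"
    proof (rule phi_star_le)
      fix y :: real
      assume y: "y \<ge> 0"
      have "y - phi \<omega> y / x \<le> h + Q (C * l) k - s"
      proof (cases "y \<ge> y0")
        case True
        then show ?thesis using key[of y] h by linarith
      next
        case False
        have "phi \<omega> y / x \<ge> 0" using phi_nonneg x by simp
        then show ?thesis using False key[of y0] h_le by linarith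
      qed
      then have "x * (y - phi \<omega> y / x) \<le> x * (h + Q (C * l) k - s)"
        using x by (intro mult_left_mono) auto
      then show "x * y - phi \<omega> y \<le> x * (h + Q (C * l) k - s)"
        using x by (simp add: right_diff_distrib)
    qed
    then have "Q l j \<le> h + Q (C * l) k - s"
      using x by (simp add: Q_def x_def[symmetric] field_simps)
    then show ?thesis by (simp add: s_def)
  qed
  then show "\<exists>l'>0. \<exists>h\<ge>0. \<forall>j k. 1 \<le> j \<longrightarrow> j \<le> k \<longrightarrow> Q l j + ln (real k / real j) \<le> h + Q l' k"
    using h C l by (intro exI[of _ "C * l"] conjI exI[of _ h]) auto
qed

text \<open>In the estimate of \<open>phi \<omega> (y + s)\<close> the supporting slope \<open>x\<close> at \<open>y + s\<close> is rounded to a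
  multiple \<open>l' * k\<close>, and the condition is applied with \<open>j \<approx> k / exp s\<close>, or \<open>j = 1\<close> if that is
  too small.\<close>

lemma M_rai_imp_alpha0:
  assumes "M_rai W"
  shows "alpha0 \<omega>"
proof -
  obtain l h where l: "l > 0" "h \<ge> 0"
    and rai: "\<And>j k. 1 \<le> j \<Longrightarrow> j \<le> k \<Longrightarrow> Q 1 j + ln (real k / real j) \<le> h + Q l k"
    using assms unfolding M_rai_iff by (metis zero_less_one)
  obtain L where L: "L \<ge> 1" "\<And>y. y \<ge> 0 \<Longrightarrow> phi \<omega> (y + h) \<le> L * (phi \<omega> y + 1)"
    using phi_shift by blast
  obtain T where T: "T \<ge> 0" "\<And>y. y \<ge> T \<Longrightarrow> 2 * y \<le> phi \<omega> y"
    using phi_superlinear[of 2] by (metis zero_less_numeral)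
  \<comment> \<open>Makes \<open>phi \<omega> y\<close> at least \<open>y + h + 1\<close> for
    \<open>y \<ge> y0\<close>, so that additive constants can be absorbed into it.\<close>
  define y0 where "y0 = max T (h + 1)"
  \<comment> \<open>\<open>8 * l * L\<close> is \<open>4 * l\<close> from rounding the slope and the
    index, times \<open>2 * L\<close> from the shift by \<open>h\<close>.\<close>
  define C where "C = max 1 (8 * l * L)"
  have main: "phi \<omega> (y + s) \<le> 8 * l * L * exp s * phi \<omega> y" if y: "y \<ge> y0" and s: "s \<ge> 0" for y s
  proof -
    have y1: "y \<ge> 1" "y + h + 1 \<le> phi \<omega> y" "1 \<le> phi \<omega> y"
      using y T(2)[of y] l by (auto simp: y0_def)
    have shift: "phi \<omega> (y + h) \<le> 2 * L * phi \<omega> y"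
    proof -
      have "L * (phi \<omega> y + 1) \<le> L * (phi \<omega> y + phi \<omega> y)"
        using y1 L(1) by (intro mult_left_mono) auto
      then show ?thesis using L(2)[of y] y1 by (simp add: algebra_simps)
    qed
    have enough: "c * l * exp s * phi \<omega> y \<le> 8 * l * L * exp s * phi \<omega> y" if "c \<le> 8" "c \<ge> 0" for c
    proof -
      have "c * l \<le> 8 * L * l" using that l L by (intro mult_right_mono) auto
      then show ?thesis using phi_nonneg by (intro mult_right_mono) (auto simp: mult.commute mult.left_commute)
    qed
    obtain x where x: "x \<ge> 0" "phi \<omega> (y + s) \<le> x * (y + s) - phi_star \<omega> x"
      using phi_attained[of "y + s"] by blast
    show ?thesis
    proof (cases "x < l")
      \<comment> \<open>Here the slope is too small for an index \<open>k \<ge> 1\<close>; the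
        nonnegative conjugate is simply dropped.\<close>
      case True
      have "y + s \<le> exp s * (y + 1)"
      proof -
        have "1 + s \<le> exp s" by (rule exp_ge_add_one_self)
        moreover have "1 * y \<le> exp s * y" using s y1 by (intro mult_right_mono) auto
        ultimately show ?thesis unfolding distrib_left by linarith
      qed
      also have "\<dots> \<le> exp s * phi \<omega> y" using y1 l by (intro mult_left_mono) auto
      finally have ys: "y + s \<le> exp s * phi \<omega> y" .
      have "phi \<omega> (y + s) \<le> x * (y + s)" using x phi_star_nonneg[of x] by linarith
      also have "\<dots> \<le> l * (exp s * phi \<omega> y)" using True x ys y1 s l by (intro mult_mono) auto
      finally show ?thesis using enough[of 1] by (simp add: mult.assoc)
    next
      case False
      \<comment> \<open>Rounding down to \<open>l * k\<close> loses at most a factor 2, and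
        \<open>Q l k\<close> stays below \<open>phi_star \<omega> x / x\<close> because the quotient
        is monotone.\<close>
      define k where "k = nat \<lfloor>x / l\<rfloor>"
      have "x / l \<ge> 1" using False l by simp
      then have k: "k \<ge> 1" "real k \<le> x / l" "x / l < real k + 1"
        unfolding k_def by linarith+
      have "l * 1 \<le> l * real k" using k l by (intro mult_left_mono) auto
      moreover have "l * real k \<le> x" "x < l * real k + l" using k l by (auto simp: field_simps)
      ultimately have lk: "l * real k \<le> x" "x \<le> 2 * l * real k" by linarith+
      have "Q l k \<le> phi_star \<omega> x / x"
        unfolding Q_def using lk l k by (intro phi_star_quot_mono) auto
      then have "x * Q l k \<le> phi_star \<omega> x"
        using False l by (simp add: field_simps)
      then have bound: "phi \<omega> (y + s) \<le> x * (y + s - Q l k)"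
        using x by (simp add: algebra_simps)
      \<comment> \<open>The ideal real value of \<open>j\<close>, for which
        \<open>ln (k / j) = s\<close>.\<close>
      define v where "v = real k * exp (- s)"
      have v: "v > 0" "real k = v * exp s" "ln v = ln (real k) - s"
        using k by (auto simp: v_def ln_mult simp flip: exp_add)
      have "v \<le> real k" using s mult_left_le[of "exp (- s)" "real k"] by (simp add: v_def)
      show ?thesis
      proof (cases "v \<ge> 1")
        case True
        define j where "j = nat \<lfloor>v\<rfloor>"
        have j: "j \<ge> 1" "real j \<le> v" "v < real j + 1" using True unfolding j_def by linarith+
        have "j \<le> k" using j \<open>v \<le> real k\<close> by linarith
        have "ln (real j) \<le> ln v" using j by (intro ln_mono) auto
        then have "s \<le> ln (real k / real j)" using j k v(3) by (simp add: ln_div)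
        then have "y + s - Q l k \<le> (y + h) - Q 1 j" using rai[OF j(1) \<open>j \<le> k\<close>] by linarith
        also have "\<dots> \<le> phi \<omega> (y + h) / real j"
        proof -
          have "real j * (y + h) - phi_star \<omega> (real j) \<le> phi \<omega> (y + h)"
            using phi_star_ge[of "y + h" "real j"] y1 l by simp
          then have "(real j * (y + h) - phi_star \<omega> (real j)) / real j \<le> phi \<omega> (y + h) / real j"
            by (intro divide_right_mono) auto
          then show ?thesis using j by (simp add: Q_def diff_divide_distrib)
        qed
        also have "\<dots> \<le> (2 * L * phi \<omega> y) / real j" using shift by (intro divide_right_mono) auto
        finally have "x * (y + s - Q l k) \<le> x * ((2 * L * phi \<omega> y) / real j)"
          using x by (intro mult_left_mono) auto
        also have "\<dots> \<le> (4 * l * exp s * real j) * ((2 * L * phi \<omega> y) / real j)"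
        proof (rule mult_right_mono)
          have "v \<le> 2 * real j" using j by linarith
          then have "v * (2 * l * exp s) \<le> 2 * real j * (2 * l * exp s)"
            using l by (intro mult_right_mono) auto
          then show "x \<le> 4 * l * exp s * real j" using lk(2) v(2) by (simp add: algebra_simps)
          show "0 \<le> (2 * L * phi \<omega> y) / real j" using L phi_nonneg by simp
        qed
        also have "\<dots> = 8 * l * L * exp s * phi \<omega> y" using j by simp
        finally show ?thesis using bound by linarith
      next
        \<comment> \<open>Now \<open>j = 1\<close>, and \<open>Q 1 1\<close> is dropped. The
          unwanted \<open>- ln v\<close> is harmless because it is multiplied by \<open>v\<close>
          and \<open>v * ln (1 / v) \<le> 1\<close>.\<close>
        case False
        have "y + s - Q l k \<le> y + h - ln v"
          using rai[of 1 k] k Q_nonneg[of 1 1] v(3) by simp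
        then have "x * (y + s - Q l k) \<le> x * (y + h - ln v)" using x by (intro mult_left_mono) auto
        also have "\<dots> \<le> (2 * l * exp s * v) * (y + h - ln v)"
        proof (rule mult_right_mono)
          show "x \<le> 2 * l * exp s * v" using lk(2) v(2) by (simp add: mult_ac)
          have "ln v \<le> 0" using False v(1) by simp
          then show "0 \<le> y + h - ln v" using y1 l by linarith
        qed
        also have "\<dots> = 2 * l * exp s * (v * (y + h) + v * ln (1 / v))"
          using v by (simp add: ln_div algebra_simps)
        also have "\<dots> \<le> 2 * l * exp s * (1 * (y + h) + 1)"
        proof (intro mult_left_mono add_mono mult_right_mono)
          have "v * ln (1 / v) \<le> v * (1 / v - 1)" using v by (intro mult_left_mono ln_le_minus_one) auto
          then show "v * ln (1 / v) \<le> 1" using v by (simp add: right_diff_distrib)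
        qed (use False y1 l in auto)
        also have "\<dots> \<le> 2 * l * exp s * phi \<omega> y" using y1 l by (intro mult_left_mono) auto
        finally show ?thesis using bound enough[of 2] by linarith
      qed
    qed
  qed
  have "\<omega> (s * t) \<le> C * s * \<omega> t" if "s \<ge> 1" "t \<ge> exp y0" for s t
  proof -
    have t: "t > 0" using that(2) exp_gt_zero[of y0] by linarith
    have "y0 \<le> ln t" using that(2) t by (simp add: ln_ge_iff)
    then have "phi \<omega> (ln t + ln s) \<le> 8 * l * L * exp (ln s) * phi \<omega> (ln t)"
      using that(1) by (intro main) auto
    then have "\<omega> (s * t) \<le> 8 * l * L * s * \<omega> t"
      using that(1) t by (simp add: phi_def exp_add mult.commute)
    also have "\<dots> \<le> C * s * \<omega> t"
      using that(1) phi_nonneg[of "ln t"] t by (intro mult_right_mono) (auto simp: C_def phi_def)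
    finally show ?thesis .
  qed
  then show ?thesis unfolding alpha0_def
    by (intro exI[of _ C] conjI exI[of _ "exp y0"]) (auto simp: C_def)
qed

section \<open>Root almost increase: a sufficient condition and geometric majorants\<close>

lemma M_rai_if_multiples:
  assumes "\<And>l. l > 0 \<Longrightarrow>
    \<exists>l'>0. \<exists>D\<ge>1. \<forall>j m. 1 \<le> j \<longrightarrow> 1 \<le> m \<longrightarrow> V l j ^ m \<le> D ^ (j * m) * V l' (j * m)"
  shows "M_rai W"
  unfolding M_rai_iff
proof (intro allI impI)
  fix l :: real
  assume l: "l > 0"
  obtain l' D where l': "l' > 0" "D \<ge> 1"
    and D: "\<And>j m. 1 \<le> j \<Longrightarrow> 1 \<le> m \<Longrightarrow> V l j ^ m \<le> D ^ (j * m) * V l' (j * m)"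
    using assms[OF l] by blast
  have "Q l j + ln (real k / real j) \<le> (ln D + 1 + ln 2) + Q l' k" if jk: "1 \<le> j" "j \<le> k" for j k
  proof -
    \<comment> \<open>\<open>j * m\<close> is the largest multiple of \<open>j\<close> not exceeding
      \<open>k\<close>; since \<open>k < 2 * j * m\<close>, passing from it to \<open>k\<close>
      costs only \<open>ln 2\<close>.\<close>
    define m where "m = k div j"
    have m: "1 \<le> m" "j * m \<le> k" using jk by (auto simp: m_def div_greater_zero_iff Suc_le_eq)
    have "k < j * m + j" using jk dividend_less_times_div[of j k] by (simp add: m_def add.commute)
    also have "\<dots> \<le> 2 * (j * m)" using jk m by auto
    finally have "real k / real j \<le> 2 * real m"
      using jk of_nat_mono[of k "2 * (j * m)", where ?'a = real] by (simp add: field_simps)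
    then have "ln (real k / real j) \<le> ln (2 * real m)" using jk m by (intro ln_mono) auto
    then have ln_k: "ln (real k / real j) \<le> ln 2 + ln (real m)" using m by (simp add: ln_mult)
    have "ln (V l j ^ m) \<le> ln (D ^ (j * m) * V l' (j * m))"
      using D[OF jk(1) m(1)] V_pos l' by (intro ln_mono) auto
    then have "real m * ln (V l j) \<le> real (j * m) * ln D + ln (V l' (j * m))"
      using V_pos[of l j] V_pos[of l' "j * m"] l' by (simp add: ln_mult ln_realpow)
    then have "real (j * m) * Q l j \<le> real (j * m) * ln D + real (j * m) * Q l' (j * m)
        - ln (fact (j * m)) + real m * ln (fact j)"
      using ln_V[of l j] ln_V[of l' "j * m"] l l' jk m by (simp add: algebra_simps)
    also have "\<dots> \<le> real (j * m) * ln D + real (j * m) * Q l' (j * m)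
        - real (j * m) * (ln (real (j * m)) - 1) + real m * (real j * ln (real j))"
      by (intro add_mono diff_mono mult_left_mono ln_fact_le ln_fact_ge) auto
    also have "\<dots> = real (j * m) * (ln D + Q l' (j * m) + 1 - ln (real m))"
      using jk m by (simp add: ln_mult algebra_simps)
    finally have "Q l j \<le> ln D + Q l' (j * m) + 1 - ln (real m)"
      using jk m by (subst (asm) mult_le_cancel_left_pos) auto
    moreover have "Q l' (j * m) \<le> Q l' k" using jk m l' by (intro Q_mono) auto
    ultimately show ?thesis using ln_k by linarith
  qed
  then show "\<exists>l'>0. \<exists>h\<ge>0. \<forall>j k. 1 \<le> j \<longrightarrow> j \<le> k \<longrightarrow> Q l j + ln (real k / real j) \<le> h + Q l' k"
    using l' by (intro exI[of _ l'] conjI exI[of _ "ln D + 1 + ln 2"]) auto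
qed

text \<open>\<open>E\<close> is the \<open>k\<close>-th root of \<open>H ^ k * V l' k\<close>. It
  depends on \<open>k\<close>, but up to that order it majorises \<open>V l\<close> geometrically,
  so that products of terms only add exponents.\<close>

lemma M_rai_root:
  assumes "M_rai W" "l > 0"
  obtains l' H where "l' > 0" "H \<ge> 1"
    "\<And>k. \<exists>E>0. E ^ k = H ^ k * V l' k \<and> (\<forall>j\<le>k. V l j \<le> E ^ j)"
proof -
  obtain l' H where l': "l' > 0" "H \<ge> 1"
    and H: "\<forall>j k. 1 \<le> j \<and> j \<le> k \<longrightarrow> V l j powr (1 / real j) \<le> H * V l' k powr (1 / real k)"
    using assms unfolding M_rai_def by blast
  have root: "(V m n powr (1 / real n)) ^ n = V m n" if "n \<ge> 1" for m n
    using that V_pos[of m n] powr_realpow[of "V m n powr (1 / real n)" n] by (simp add: powr_powr)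
  have "\<exists>E>0. E ^ k = H ^ k * V l' k \<and> (\<forall>j\<le>k. V l j \<le> E ^ j)" for k
  proof (cases "k = 0")
    case True
    then show ?thesis by (intro exI[of _ 1]) (simp add: V_0)
  next
    case False
    define E where "E = H * V l' k powr (1 / real k)"
    have E: "E > 0" using l' V_pos[of l' k] by (simp add: E_def)
    have "V l j \<le> E ^ j" if "j \<le> k" for j
    proof (cases "j = 0")
      case False
      have "(V l j powr (1 / real j)) ^ j \<le> E ^ j"
        unfolding E_def using H[rule_format, of j k] False that by (intro power_mono) auto
      then show ?thesis using root[of j l] False by simp
    qed (simp add: V_0)
    moreover have "E ^ k = H ^ k * V l' k"
      using root[of k l'] False by (simp add: E_def power_mult_distrib)
    ultimately show ?thesis using E by blast
  qed
  then show thesis using that l' by blast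
qed

text \<open>One geometric majorant, taken at order \<open>p + q\<close>, serves both
  factors.\<close>

lemma M_rai_merge:
  assumes "M_rai W" "l > 0"
  obtains l' H where "l' > 0" "H \<ge> 1" "\<And>p q. V l p * V l q \<le> H ^ (p + q) * V l' (p + q)"
proof -
  obtain l' H where l': "l' > 0" "H \<ge> 1"
    and H: "\<And>k. \<exists>E>0. E ^ k = H ^ k * V l' k \<and> (\<forall>j\<le>k. V l j \<le> E ^ j)"
    using M_rai_root[OF assms] by metis
  have "V l p * V l q \<le> H ^ (p + q) * V l' (p + q)" for p q
  proof -
    obtain E where E: "E > 0" "E ^ (p + q) = H ^ (p + q) * V l' (p + q)" "\<forall>j\<le>p+q. V l j \<le> E ^ j"
      using H by blast
    have "V l p * V l q \<le> E ^ p * E ^ q"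
      using E V_pos by (intro mult_mono) (auto intro: less_imp_le)
    then show ?thesis using E by (simp add: power_add)
  qed
  then show thesis using that l' by blast
qed

lemma M_rai_fact_le:
  assumes "M_rai W"
  obtains l H where "l > 0" "H \<ge> 1" "\<And>k. fact k \<le> H ^ k * W l k"
proof -
  obtain l H where l: "l > 0" "H \<ge> 1"
    and H: "\<And>k. \<exists>E>0. E ^ k = H ^ k * V l k \<and> (\<forall>j\<le>k. V 1 j \<le> E ^ j)"
    using M_rai_root[OF assms, of 1] by (metis zero_less_one)
  have "fact k \<le> H ^ k * W l k" for k
  proof (cases "k = 0")
    case False
    obtain E where E: "E > 0" "E ^ k = H ^ k * V l k" "\<forall>j\<le>k. V 1 j \<le> E ^ j"
      using H by blast
    \<comment> \<open>The majorant satisfies \<open>E \<ge> V 1 1 \<ge> 1\<close>, hence so does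
      \<open>E ^ k\<close>.\<close>
    have "1 \<le> V 1 1" using W_ge_1[of 1 1] by (simp add: check_def)
    also have "\<dots> \<le> E" using E(3)[rule_format, of 1] False by simp
    finally have "1 \<le> H ^ k * V l k" using one_le_power[of E k] E(2) by simp
    then show ?thesis by (simp add: check_def field_simps)
  qed (simp add: W_0)
  then show thesis using that l by blast
qed

text \<open>Shifting the index by one makes the bound submultiplicative with exponent the sum of the
  indices minus their number, as needed for the composite of two functions of the class.\<close>

lemma M_rai_shifted_root:
  assumes "M_rai W" "l > 0"
  obtains l' c H where "l' > 0" "c \<ge> 1" "H \<ge> 1"
    "\<And>N. \<exists>E>0. E ^ N = H ^ N * V l' N \<and> (\<forall>j. 1 \<le> j \<longrightarrow> j \<le> Suc N \<longrightarrow> V l j \<le> c * E ^ (j - 1))"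
proof -
  obtain l' H where l': "l' > 0" "H \<ge> 1"
    and H: "\<And>k. \<exists>E>0. E ^ k = H ^ k * V l' k \<and> (\<forall>j\<le>k. V (2 * l) j \<le> E ^ j)"
    using M_rai_root[OF assms(1), of "2 * l"] assms(2) by (metis mult_pos_pos zero_less_numeral)
  \<comment> \<open>The price of splitting off one index by \<open>W_add\<close>; the parameter
    doubles with it.\<close>
  define c where "c = W (2 * l) 1"
  have c: "c \<ge> 1" using W_ge_1 assms(2) by (simp add: c_def)
  have V_Suc: "V l (Suc j) \<le> c * V (2 * l) j" for j
  proof -
    have "V l (Suc j) \<le> (W (2 * l) 1 * W (2 * l) j) / fact (Suc j)"
      unfolding check_def using W_add[OF assms(2), of 1 j] by (intro divide_right_mono) auto
    also have "\<dots> \<le> (W (2 * l) 1 * W (2 * l) j) / fact j"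
      using W_pos[of "2 * l" 1] W_pos[of "2 * l" j] by (intro divide_left_mono fact_mono) auto
    finally show ?thesis by (simp add: c_def check_def)
  qed
  have "\<exists>E>0. E ^ N = H ^ N * V l' N \<and> (\<forall>j. 1 \<le> j \<longrightarrow> j \<le> Suc N \<longrightarrow> V l j \<le> c * E ^ (j - 1))" for N
  proof -
    obtain E where E: "E > 0" "E ^ N = H ^ N * V l' N" "\<forall>j\<le>N. V (2 * l) j \<le> E ^ j"
      using H by blast
    have "V l j \<le> c * E ^ (j - 1)" if "1 \<le> j" "j \<le> Suc N" for j
    proof -
      have "V l j \<le> c * V (2 * l) (j - 1)" using V_Suc[of "j - 1"] that by simp
      also have "\<dots> \<le> c * E ^ (j - 1)" using E(3) that c by (intro mult_left_mono) auto
      finally show ?thesis .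
    qed
    then show ?thesis using E by blast
  qed
  then show thesis using that l' c by blast
qed

end

section \<open>Compositions of an integer and the Faa di Bruno condition\<close>

lemma length_le_sum_list:
  fixes js :: "nat list"
  assumes "\<forall>j\<in>set js. 1 \<le> j"
  shows "length js \<le> sum_list js"
  using assms by (induction js) auto

text \<open>The other entries are at least 1. With \<open>n\<close> entries of sum \<open>k\<close>,
  no entry exceeds \<open>k - n + 1\<close>, which is the range covered by
  \<open>M_rai_shifted_root\<close> at \<open>N = k - n\<close>.\<close>

lemma member_le_sum_list_minus_length:
  fixes js :: "nat list"
  assumes "\<forall>j\<in>set js. 1 \<le> j" "i \<in> set js"
  shows "i + length js \<le> Suc (sum_list js)"
  using assms
proof (induction js)
  case (Cons a js)
  then show ?case using length_le_sum_list[of js] by auto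
qed simp

lemma prod_list_le_power:
  fixes f :: "nat \<Rightarrow> real"
  assumes "\<forall>j\<in>set js. 1 \<le> j \<and> 0 \<le> f j \<and> f j \<le> c * E ^ (j - 1)" "0 \<le> c" "0 \<le> E"
  shows "(\<Prod>j\<leftarrow>js. f j) \<le> c ^ length js * E ^ (sum_list js - length js)"
  using assms(1)
proof (induction js)
  case (Cons a js)
  have "(\<Prod>j\<leftarrow>js. f j) \<ge> 0" using Cons.prems by (intro prod_list_nonneg) auto
  then have "(\<Prod>j\<leftarrow>a # js. f j) \<le> (c * E ^ (a - 1)) * (c ^ length js * E ^ (sum_list js - length js))"
    using Cons assms by (simp add: mult_mono)
  also have "(a - 1) + (sum_list js - length js) = sum_list (a # js) - length (a # js)"
    using Cons.prems length_le_sum_list[of js] by auto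
  then have "(c * E ^ (a - 1)) * (c ^ length js * E ^ (sum_list js - length js)) =
      c ^ length (a # js) * E ^ (sum_list (a # js) - length (a # js))"
    by (metis (no_types, lifting) length_Cons mult.assoc mult.left_commute power_Suc power_add)
  finally show ?case .
qed simp

text \<open>Positivity bounds both length and entries by \<open>k\<close>. Finiteness is what gives
  \<open>Max\<close> in \<open>circ\<close> its meaning.\<close>

lemma finite_compositions:
  "finite {m (length js) * (\<Prod>j\<leftarrow>js. m j) :: real | js.
     length js \<ge> 1 \<and> (\<forall>j\<in>set js. j \<ge> 1) \<and> sum_list js = k}"
proof -
  have "finite {js. length js \<ge> 1 \<and> (\<forall>j\<in>set js. j \<ge> 1) \<and> sum_list js = k}"
  proof (rule finite_subset)
    show "finite {js. set js \<subseteq> {..k} \<and> length js \<le> k}" by (rule finite_lists_length_le) simp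
    show "{js. length js \<ge> 1 \<and> (\<forall>j\<in>set js. j \<ge> 1) \<and> sum_list js = k} \<subseteq>
        {js. set js \<subseteq> {..k} \<and> length js \<le> k}"
      using length_le_sum_list member_le_sum_list by fastforce
  qed
  then show ?thesis by (rule finite_image_set)
qed

context weight_function
begin

lemma M_rai_imp_M_FdB:
  assumes "M_rai W"
  shows "M_FdB W"
  unfolding M_FdB_def
proof (intro allI impI)
  fix l :: real
  assume l: "l > 0"
  obtain l1 c H where l1: "l1 > 0" "c \<ge> 1" "H \<ge> 1"
    and root: "\<And>N. \<exists>E>0. E ^ N = H ^ N * V l1 N \<and> (\<forall>j. 1 \<le> j \<longrightarrow> j \<le> Suc N \<longrightarrow> V l j \<le> c * E ^ (j - 1))"
    using M_rai_shifted_root[OF assms l] by metis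
  define l2 where "l2 = max l l1"
  obtain l3 G where l3: "l3 > 0" "G \<ge> 1" "\<And>p q. V l2 p * V l2 q \<le> G ^ (p + q) * V l3 (p + q)"
    using M_rai_merge[OF assms, of l2] l by (metis l2_def less_max_iff_disj)
  have bound: "V l (length js) * (\<Prod>j\<leftarrow>js. V l j) \<le> (c * H * G) ^ k * V l3 k"
    if js: "\<forall>j\<in>set js. j \<ge> 1" "sum_list js = k" for js k
  proof -
    define n where "n = length js"
    \<comment> \<open>With the majorant taken at this order, the product is at most
      \<open>c ^ n * E ^ N\<close>; then \<open>V l n * V l1 N\<close> has total order
      \<open>k\<close> and can be merged.\<close>
    define N where "N = k - n"
    have n: "n + N = k" using length_le_sum_list[of js] js by (auto simp: n_def N_def)
    obtain E where E: "E > 0" "E ^ N = H ^ N * V l1 N"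
        "\<And>j. 1 \<le> j \<Longrightarrow> j \<le> Suc N \<Longrightarrow> V l j \<le> c * E ^ (j - 1)"
      using root[of N] by blast
    have "(\<Prod>j\<leftarrow>js. V l j) \<le> c ^ length js * E ^ (sum_list js - length js)"
    proof (rule prod_list_le_power)
      show "\<forall>j\<in>set js. 1 \<le> j \<and> 0 \<le> V l j \<and> V l j \<le> c * E ^ (j - 1)"
      proof
        fix j
        assume "j \<in> set js"
        then have "1 \<le> j" "j \<le> Suc N"
          using js n member_le_sum_list_minus_length[of js j] by (auto simp: n_def)
        then show "1 \<le> j \<and> 0 \<le> V l j \<and> V l j \<le> c * E ^ (j - 1)"
          using E(3) V_pos[of l j] by auto
      qed
    qed (use l1 E in auto)
    then have "V l n * (\<Prod>j\<leftarrow>js. V l j) \<le> V l n * (c ^ n * (H ^ N * V l1 N))"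
      using V_pos[of l n] js E by (intro mult_left_mono) (auto simp: n_def N_def)
    also have "\<dots> = (c ^ n * H ^ N) * (V l n * V l1 N)" by simp
    also have "\<dots> \<le> (c ^ k * H ^ k) * (V l2 n * V l2 N)"
      using n l l1 V_pos[of l n] V_pos[of l1 N]
      by (intro mult_mono power_increasing V_mono) (auto simp: l2_def intro: less_imp_le order.trans[OF _ V_mono])
    also have "\<dots> \<le> (c ^ k * H ^ k) * (G ^ k * V l3 k)"
      using l3(3)[of n N] n l1 by (intro mult_left_mono) auto
    finally show ?thesis by (simp add: n_def power_mult_distrib)
  qed
  have "circ (V l) k \<le> 1 * (c * H * G) ^ k * V l3 k" for k
  proof (cases "k = 0")
    case False
    then have "\<exists>js. length js \<ge> 1 \<and> (\<forall>j\<in>set js. j \<ge> 1) \<and> sum_list js = k"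
      by (intro exI[of _ "[k]"]) auto
    then have "Max {V l (length js) * (\<Prod>j\<leftarrow>js. V l j) | js.
        length js \<ge> 1 \<and> (\<forall>j\<in>set js. j \<ge> 1) \<and> sum_list js = k} \<le> (c * H * G) ^ k * V l3 k"
      using bound by (intro Max.boundedI[OF finite_compositions]) blast+
    then show ?thesis using False by (simp add: circ_def)
  qed (simp add: circ_def V_0)
  then show "\<exists>l'>0. \<exists>A>0. \<exists>B>0. \<forall>k. circ (V l) k \<le> A * B ^ k * V l' k"
    using l1 l3 by (intro exI[of _ l3] conjI exI[of _ "c * H * G"] exI[of _ 1]) auto
qed

text \<open>Testing \<open>phi_star\<close> with slope \<open>l * j\<close> at
  \<open>y = ln j\<close>, where \<open>phi \<omega> y\<close> is at most linear in
  \<open>j\<close>, gives \<open>l * j * ln j\<close> up to a linear error; then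
  \<open>j! \<le> j^j\<close>.\<close>

lemma linear_imp_fact_le:
  assumes "\<omega> \<in> O[at_top](\<lambda>t. t)" "l > 0"
  obtains h where "h \<ge> 1" "\<And>j. fact j \<le> h * h ^ j * W l j"
proof -
  obtain c where c: "c > 0" "eventually (\<lambda>t. norm (\<omega> t) \<le> c * norm t) at_top"
    using landau_o.bigE[OF assms(1)] by blast
  from c(2) obtain N where N: "\<And>t. t \<ge> N \<Longrightarrow> \<bar>\<omega> t\<bar> \<le> c * \<bar>t\<bar>"
    by (auto simp: eventually_at_top_linorder)
  define M where "M = max N 1"
  define a where "a = max c (\<omega> M)"
  have a: "a > 0" using c by (simp add: a_def)
  have phi_le: "phi \<omega> y \<le> a * exp y + a" if "y \<ge> 0" for y
  proof (cases "exp y \<ge> M")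
    case True
    then have "phi \<omega> y \<le> c * exp y" using N[of "exp y"] by (auto simp: phi_def M_def)
    also have "\<dots> \<le> a * exp y" by (simp add: a_def)
    finally show ?thesis using a by simp
  next
    case False
    moreover have "M > 0" by (simp add: M_def)
    ultimately have "y \<le> ln M" by (simp add: ln_ge_iff)
    then have "phi \<omega> y \<le> phi \<omega> (ln M)" by (rule phi_mono)
    also have "\<dots> \<le> a" by (simp add: phi_def M_def a_def)
    finally show ?thesis using a by (meson add_increasing exp_ge_zero less_imp_le mult_nonneg_nonneg)
  qed
  have "fact j \<le> exp (a / l) * exp (a / l) ^ j * W l j" for j
  proof (cases "j = 0")
    case False
    have "l * real j * ln (real j) - phi \<omega> (ln (real j)) \<le> phi_star \<omega> (l * real j)"
      using False by (intro phi_star_ge) simp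
    then have "l * (real j * ln (real j)) - (a * real j + a) \<le> phi_star \<omega> (l * real j)"
      using phi_le[of "ln (real j)"] False by simp
    then have "(l * (real j * ln (real j)) - (a * real j + a)) / l \<le> phi_star \<omega> (l * real j) / l"
      using assms by (intro divide_right_mono) auto
    then have "real j * ln (real j) \<le> a / l + real j * (a / l) + 1 / l * phi_star \<omega> (l * real j)"
      using assms by (simp add: diff_divide_distrib add_divide_distrib algebra_simps)
    then have "ln (fact j) \<le> a / l + real j * (a / l) + 1 / l * phi_star \<omega> (l * real j)"
      using ln_fact_le[of j] by linarith
    then have "exp (ln (fact j)) \<le> exp (a / l + real j * (a / l) + 1 / l * phi_star \<omega> (l * real j))"
      by (simp only: exp_le_cancel_iff)
    then show ?thesis
      by (simp only: exp_ln fact_gt_zero exp_add exp_of_nat_mult weight_matrix_def)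
  qed (use a assms in \<open>simp add: W_0\<close>)
  then show thesis using that[of "exp (a / l)"] a assms by simp
qed

text \<open>The tuple of \<open>m\<close> entries \<open>j\<close> yields a bound for
  \<open>V l m * V l j ^ m\<close>. The outer factor \<open>V l m\<close> is removed by its
  geometric lower bound, which comes from linear growth.\<close>

lemma M_FdB_imp_M_rai:
  assumes "\<omega> \<in> O[at_top](\<lambda>t. t)" "M_FdB W"
  shows "M_rai W"
proof (rule M_rai_if_multiples)
  fix l :: real
  assume l: "l > 0"
  obtain l' A B where l': "l' > 0" "A > 0" "B > 0"
    and FdB: "\<And>k. circ (V l) k \<le> A * B ^ k * V l' k"
    using assms(2) l unfolding M_FdB_def by blast
  obtain h where h: "h \<ge> 1" "\<And>j. fact j \<le> h * h ^ j * W l j"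
    using linear_imp_fact_le[OF assms(1) l] by blast
  have hV: "1 \<le> h * h ^ j * V l j" for j
    using h(2)[of j] by (simp add: check_def field_simps)
  define D where "D = max 1 A * max 1 B * h * h"
  have "V l j ^ m \<le> D ^ (j * m) * V l' (j * m)" if "1 \<le> j" "1 \<le> m" for j m
  proof -
    have jm: "m \<le> j * m" "1 \<le> j * m" using that by auto
    have "V l m * V l j ^ m \<le> circ (V l) (j * m)"
    proof -
      have "V l m * V l j ^ m \<in> {V l (length js) * (\<Prod>j\<leftarrow>js. V l j) | js.
          length js \<ge> 1 \<and> (\<forall>j\<in>set js. j \<ge> 1) \<and> sum_list js = j * m}"
        using that by (intro CollectI exI[of _ "replicate m j"]) (auto simp: sum_list_replicate prod_list_replicate)
      then show ?thesis using that Max_ge[OF finite_compositions] by (simp add: circ_def)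
    qed
    also have "\<dots> \<le> A * B ^ (j * m) * V l' (j * m)" by (rule FdB)
    finally have *: "V l m * V l j ^ m \<le> A * B ^ (j * m) * V l' (j * m)" .
    have "V l j ^ m \<le> (h * h ^ m * V l m) * V l j ^ m"
      using hV[of m] V_pos[of l j] by (simp add: mult_le_cancel_right1)
    also have "\<dots> = (h * h ^ m) * (V l m * V l j ^ m)" by simp
    also have "\<dots> \<le> (h * h ^ m) * (A * B ^ (j * m) * V l' (j * m))"
      using * h by (intro mult_left_mono) auto
    also have "\<dots> \<le> (h ^ (j * m) * h ^ (j * m)) * (max 1 A ^ (j * m) * max 1 B ^ (j * m) * V l' (j * m))"
    proof (intro mult_mono order.refl)
      show "h \<le> h ^ (j * m)" using power_increasing[OF jm(2), of h] h by simp
      show "h ^ m \<le> h ^ (j * m)" using power_increasing[OF jm(1), of h] h by simp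
      show "A \<le> max 1 A ^ (j * m)" using power_increasing[OF jm(2), of "max 1 A"] by simp
      show "B ^ (j * m) \<le> max 1 B ^ (j * m)" using l' by (intro power_mono) auto
    qed (use h l' V_pos[of l' "j * m"] in auto)
    also have "\<dots> = D ^ (j * m) * V l' (j * m)" by (simp add: D_def power_mult_distrib)
    finally show ?thesis .
  qed
  moreover have "1 * 1 * 1 * 1 \<le> D"
    unfolding D_def using h by (intro mult_mono) auto
  ultimately show "\<exists>l'>0. \<exists>D\<ge>1. \<forall>j m. 1 \<le> j \<longrightarrow> 1 \<le> m \<longrightarrow> V l j ^ m \<le> D ^ (j * m) * V l' (j * m)"
    using l' by (intro exI[of _ l'] conjI exI[of _ D]) auto
qed

end

section \<open>Stability of the function classes\<close>

lemma sector_subset_Re_pos: "\<alpha> \<le> 1 \<Longrightarrow> sector \<alpha> \<subseteq> {z. Re z > 0}"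
proof
  fix z
  assume \<alpha>: "\<alpha> \<le> 1" and z: "z \<in> sector \<alpha>"
  have "\<alpha> * pi \<le> 1 * pi" using \<alpha> by (intro mult_right_mono) auto
  moreover have "\<bar>Arg z\<bar> < \<alpha> * pi / 2" using z by (simp add: sector_def)
  ultimately have "\<bar>Arg z\<bar> < pi / 2" by linarith
  then show "z \<in> {z. Re z > 0}" using z unfolding Arg_Re_pos by (simp add: sector_def)
qed

text \<open>In the right half-plane, which contains the sector for \<open>\<alpha> \<le> 1\<close>,
  \<open>Arg\<close> is continuous.\<close>

lemma open_sector:
  assumes "\<alpha> \<le> 1"
  shows "open (sector \<alpha>)"
proof -
  have "open ({z. Re z > 0} \<inter> (\<lambda>z. \<bar>Arg z\<bar>) -` {..<\<alpha> * pi / 2})"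
    by (intro continuous_open_preimage continuous_intros open_halfspace_Re_gt)
       (auto simp: complex_nonpos_Reals_iff)
  also have "{z. Re z > 0} \<inter> (\<lambda>z. \<bar>Arg z\<bar>) -` {..<\<alpha> * pi / 2} = sector \<alpha>"
    using sector_subset_Re_pos[OF assms] by (auto simp: sector_def)
  finally show ?thesis .
qed

lemma of_real_in_sector: "0 < \<alpha> \<Longrightarrow> x > 0 \<Longrightarrow> of_real x \<in> sector \<alpha>"
  by (simp add: sector_def Arg_of_real)

text \<open>Up to order \<open>Suc N\<close>, \<open>b\<close> is majorised by
  \<open>c x / (1 - E x)\<close>, whose \<open>n\<close>-th power has coefficients
  \<open>c^n E^(m - n)\<close> times a binomial coefficient; \<open>2 ^ m\<close> stands in for the
  latter. Higher coefficients of \<open>b\<close> cannot contribute, as the other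
  \<open>n - 1\<close> factors have order at least 1.\<close>

lemma fps_power_nth_bound:
  fixes b :: "complex fps"
  assumes b0: "b $ 0 = 0"
    and b: "\<And>j. 1 \<le> j \<Longrightarrow> j \<le> Suc N \<Longrightarrow> norm (b $ j) \<le> c * E ^ (j - 1)"
    and nonneg: "0 \<le> c" "0 \<le> E"
    and "n \<le> m" "m - n \<le> N"
  shows "norm ((b ^ n) $ m) \<le> c ^ n * 2 ^ m * E ^ (m - n)"
  using \<open>n \<le> m\<close> \<open>m - n \<le> N\<close>
proof (induction n arbitrary: m)
  case 0
  then show ?case using nonneg by (cases m) auto
next
  case (Suc n)
  have term_le: "norm (b $ i * (b ^ n) $ (m - i)) \<le> (c ^ Suc n * E ^ (m - Suc n)) * 2 ^ (m - i)"
    if i: "i \<in> {1..m}" for i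
  proof (cases "m - i < n")
    case True
    then show ?thesis using startsby_zero_power_prefix[OF b0, of n] nonneg by simp
  next
    case False
    then have le: "n \<le> m - i" "m - i - n \<le> N" "i \<le> Suc N" using Suc.prems i by auto
    have exponents: "(i - 1) + (m - i - n) = m - Suc n" using i False Suc.prems by auto
    have "norm (b $ i * (b ^ n) $ (m - i)) \<le> (c * E ^ (i - 1)) * (c ^ n * 2 ^ (m - i) * E ^ (m - i - n))"
      unfolding norm_mult using b[of i] Suc.IH[OF le(1,2)] le i nonneg by (intro mult_mono) auto
    also have "\<dots> = (c ^ Suc n * E ^ ((i - 1) + (m - i - n))) * 2 ^ (m - i)"
      by (simp add: power_add)
    finally show ?thesis unfolding exponents .
  qed
  \<comment> \<open>The convolution sum stays below \<open>2 ^ m\<close>, so the induction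
    reproduces this factor without loss.\<close>
  have geometric: "(\<Sum>i=1..m. 2 ^ (m - i)) = (2 ^ m - 1 :: real)" for m
    by (induction m) (simp_all add: Suc_diff_le flip: sum_distrib_left)
  have "(b ^ Suc n) $ m = (\<Sum>i=0..m. b $ i * (b ^ n) $ (m - i))"
    by (simp add: fps_mult_nth)
  also have "\<dots> = (\<Sum>i=1..m. b $ i * (b ^ n) $ (m - i))"
    by (simp add: sum.atLeast_Suc_atMost b0)
  finally have "norm ((b ^ Suc n) $ m) \<le> (\<Sum>i=1..m. (c ^ Suc n * E ^ (m - Suc n)) * 2 ^ (m - i))"
    using term_le by (simp only:) (rule sum_norm_le, blast)
  also have "\<dots> = (c ^ Suc n * E ^ (m - Suc n)) * (2 ^ m - 1)"
    by (simp only: geometric flip: sum_distrib_left)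
  also have "\<dots> \<le> (c ^ Suc n * E ^ (m - Suc n)) * 2 ^ m"
    using nonneg by (intro mult_left_mono) auto
  finally show ?case by (simp only: mult_ac)
qed

lemma fps_nth_fps_expansion_at: "fps_expansion f z $ n = (deriv ^^ n) f z / fact n"
  by (simp add: fps_expansion_def)

text \<open>Faa di Bruno's formula as composition of power series; subtracting \<open>f z\<close>
  removes the constant term, so that only powers up to \<open>k\<close> contribute.\<close>

lemma higher_deriv_compose:
  assumes "f analytic_on {z}" "g analytic_on {f z}"
  shows "(deriv ^^ k) (g \<circ> f) z / fact k =
    (\<Sum>n=0..k. (deriv ^^ n) g (f z) / fact n * ((fps_expansion f z - fps_const (f z)) ^ n) $ k)"
proof -
  let ?b = "fps_expansion f z - fps_const (f z)"
  have b: "(\<lambda>x. f (z + x) - f z) has_fps_expansion ?b"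
    by (intro has_fps_expansion_diff has_fps_expansion_const analytic_at_imp_has_fps_expansion assms)
  have "((\<lambda>x. g (f z + x)) \<circ> (\<lambda>x. f (z + x) - f z)) has_fps_expansion fps_compose (fps_expansion g (f z)) ?b"
    by (intro has_fps_expansion_compose analytic_at_imp_has_fps_expansion assms b)
       (simp add: fps_nth_fps_expansion_at)
  also have "(\<lambda>x. g (f z + x)) \<circ> (\<lambda>x. f (z + x) - f z) = (\<lambda>x. (g \<circ> f) (z + x))"
    by (simp add: fun_eq_iff)
  finally have "fps_compose (fps_expansion g (f z)) ?b $ k = (deriv ^^ k) (\<lambda>x. (g \<circ> f) (z + x)) 0 / fact k"
    by (rule fps_nth_fps_expansion)
  also have "(deriv ^^ k) (\<lambda>x. (g \<circ> f) (z + x)) 0 = (deriv ^^ k) (g \<circ> f) z"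
    using higher_deriv_shift_0'[where f = "g \<circ> f" and z = z and n = k] by (simp add: o_def)
  finally show ?thesis by (simp add: fps_compose_nth fps_nth_fps_expansion_at)
qed

lemma higher_deriv_eqI:
  fixes F :: "nat \<Rightarrow> complex \<Rightarrow> complex"
  assumes "open S" "\<And>n z. z \<in> S \<Longrightarrow> (F n has_field_derivative F (Suc n) z) (at z)" "z \<in> S"
  shows "(deriv ^^ n) (F 0) z = F n z"
  using \<open>z \<in> S\<close>
proof (induction n arbitrary: z)
  case (Suc n)
  have "((deriv ^^ n) (F 0) has_field_derivative F (Suc n) z) (at z)"
    using assms(2)[OF Suc.prems] assms(1) Suc.prems
    by (rule has_field_derivative_transform_within_open) (simp add: Suc.IH)
  then show ?case by (simp add: DERIV_imp_deriv)
qed simp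

text \<open>Nonnegativity of the Taylor coefficients of \<open>1 / (c - p(x))\<close> lets one keep only the terms
  coming from a single coefficient of \<open>p\<close>.\<close>

lemma reciprocal_coeff_ge:
  fixes p q :: "nat \<Rightarrow> real"
  assumes c: "c > 0" and p: "\<And>i. p i \<ge> 0" and q0: "c * q 0 = 1"
    and q: "\<And>n. n \<ge> 1 \<Longrightarrow> c * q n = (\<Sum>i=1..n. p i * q (n - i))"
    and j: "j \<ge> 1"
  shows "(p j / c) ^ m / c \<le> q (j * m)"
proof -
  have nonneg: "q n \<ge> 0" for n
  proof (induction n rule: less_induct)
    case (less n)
    have "c * q n \<ge> 0"
    proof (cases "n = 0")
      case False
      then show ?thesis using q[of n] less p by (auto intro!: sum_nonneg mult_nonneg_nonneg)
    qed (simp add: q0)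
    then show ?case using c by (simp add: zero_le_mult_iff)
  qed
  show ?thesis
  proof (induction m)
    case 0
    then show ?case using q0 c by (simp add: field_simps)
  next
    case (Suc m)
    have "p j * ((p j / c) ^ m / c) \<le> p j * q (j * m)"
      using Suc p by (intro mult_left_mono) auto
    also have "\<dots> \<le> (\<Sum>i=1..j * Suc m. p i * q (j * Suc m - i))"
      using member_le_sum[of j "{1..j * Suc m}" "\<lambda>i. p i * q (j * Suc m - i)"] nonneg p j by simp
    also have "\<dots> = c * q (j * Suc m)" using q[of "j * Suc m"] j by simp
    finally show ?case using c by (simp add: field_simps)
  qed
qed

context weight_function
begin

section \<open>Closedness under composition and holomorphic closedness\<close>

lemma ultraholomorphic_iff:
  "f \<in> ultraholomorphic \<omega> S \<longleftrightarrow> f holomorphic_on S \<and>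
    (\<exists>l>0. \<exists>C\<ge>1. \<forall>z\<in>S. \<forall>j. norm ((deriv ^^ j) f z) \<le> C * W l j)"
proof -
  have "bdd_above {norm ((deriv ^^ j) f z) / exp (1 / l * phi_star \<omega> (l * real j)) | z j. z \<in> S} \<longleftrightarrow>
      (\<exists>C\<ge>1. \<forall>z\<in>S. \<forall>j. norm ((deriv ^^ j) f z) \<le> C * W l j)" (is "?L \<longleftrightarrow> ?R") for l
  proof
    assume ?L
    then obtain C where "\<forall>z\<in>S. \<forall>j. norm ((deriv ^^ j) f z) / W l j \<le> C"
      unfolding bdd_above_def weight_matrix_def by blast
    then have "\<forall>z\<in>S. \<forall>j. norm ((deriv ^^ j) f z) / W l j \<le> max 1 C"
      by (auto simp: max.coboundedI2)
    then show ?R using W_pos by (intro exI[of _ "max 1 C"]) (simp add: pos_divide_le_eq)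
  next
    assume ?R
    then obtain C where "\<forall>z\<in>S. \<forall>j. norm ((deriv ^^ j) f z) / W l j \<le> C"
      using W_pos by (auto simp: pos_divide_le_eq)
    then show ?L unfolding bdd_above_def weight_matrix_def by blast
  qed
  then show ?thesis by (simp add: ultraholomorphic_def)
qed

text \<open>Cauchy's inequality on discs of one radius \<open>e\<close> about the points of
  \<open>K\<close>; the resulting \<open>j! / e^j\<close> is absorbed by
  \<open>fact_le\<close>.\<close>

lemma holomorphic_imp_local_class:
  assumes "l > 0" "h > 0" and fact_le: "\<And>k. fact k \<le> A * h ^ k * W l k"
    and U: "open U" and g: "g holomorphic_on U"
  shows "g \<in> local_class W U"
proof -
  have "\<exists>l>0. \<exists>h>0. bdd_above {norm ((deriv ^^ j) g z) / (h ^ j * W l j) | z j. z \<in> K}"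
    if K: "compact K" "K \<subseteq> U" for K
  proof -
    obtain e where e: "e > 0" "(\<Union>x\<in>K. cball x e) \<subseteq> U"
      using compact_subset_open_imp_cball_epsilon_subset[OF K(1) U K(2)] by blast
    have "compact (g ` (\<Union>x\<in>K. cball x e))"
      using holomorphic_on_imp_continuous_on[OF holomorphic_on_subset[OF g e(2)]] K(1)
      by (intro compact_continuous_image compact_minkowski_sum_cball)
    then obtain B where "\<forall>y\<in>g ` (\<Union>x\<in>K. cball x e). norm y \<le> B"
      by (auto dest!: compact_imp_bounded simp only: bounded_iff)
    then have B: "norm (g y) \<le> B" if "x \<in> K" "y \<in> cball x e" for x y
      using that by blast
    have bound: "norm ((deriv ^^ j) g z) / ((h / e) ^ j * W l j) \<le> B * A" if z: "z \<in> K" for z j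
    proof -
      have "B \<ge> 0" using order.trans[OF norm_ge_zero B[of z z]] z e(1) by simp
      have "cball z e \<subseteq> U" using z e(2) by blast
      then have g': "g holomorphic_on cball z e" using g holomorphic_on_subset by blast
      have "norm ((deriv ^^ j) g z) \<le> fact j * B / e ^ j"
      proof (rule Cauchy_inequality)
        show "g holomorphic_on ball z e" using g' ball_subset_cball by (rule holomorphic_on_subset)
        show "continuous_on (cball z e) g" using g' by (rule holomorphic_on_imp_continuous_on)
        show "norm (g x) \<le> B" if "norm (z - x) = e" for x
          using B[OF z, of x] that by (simp add: dist_norm)
      qed (rule e(1))
      also have "\<dots> \<le> (A * h ^ j * W l j) * B / e ^ j"
        using fact_le[of j] \<open>B \<ge> 0\<close> e(1) by (intro divide_right_mono mult_right_mono) auto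
      also have "\<dots> = (B * A) * ((h / e) ^ j * W l j)" by (simp add: power_divide)
      finally show ?thesis
        using W_pos[of l j] assms(2) e(1) by (simp add: pos_divide_le_eq)
    qed
    show ?thesis
      using assms e(1) bound
      by (intro exI[of _ l] conjI exI[of _ "h / e"]) (auto intro!: bdd_aboveI[of _ "B * A"])
  qed
  then show ?thesis using g by (simp add: local_class_def)
qed

lemma M_rai_imp_composition_closed:
  assumes rai: "M_rai W" and S: "open S"
  shows "composition_closed \<omega> S"
  unfolding composition_closed_def
proof (intro ballI allI impI)
  fix f U g
  assume f: "f \<in> ultraholomorphic \<omega> S" and U: "open U \<and> closure (f ` S) \<subseteq> U"
    and g: "g \<in> local_class W U"
  \<comment> \<open>\<open>f\<close> is bounded, so \<open>K\<close> is compact and the local bounds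
    of \<open>g\<close> hold uniformly on it.\<close>
  define K where "K = closure (f ` S)"
  obtain l C where f_holo: "f holomorphic_on S" and l: "l > 0" "C \<ge> 1"
    and C: "\<And>z j. z \<in> S \<Longrightarrow> norm ((deriv ^^ j) f z) \<le> C * W l j"
    using f unfolding ultraholomorphic_iff by blast
  have "norm (f z) \<le> C" if "z \<in> S" for z
    using C[OF that, of 0] by (simp add: W_0)
  then have "compact K"
    unfolding K_def by (auto simp: compact_closure bounded_iff)
  then have "\<exists>l>0. \<exists>h>0. bdd_above {norm ((deriv ^^ j) g z) / (h ^ j * W l j) | z j. z \<in> K}"
    using g U by (simp add: local_class_def K_def)
  then obtain l2 h where l2: "l2 > 0" "h > 0"
    and bdd: "bdd_above {norm ((deriv ^^ j) g z) / (h ^ j * W l2 j) | z j. z \<in> K}"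
    by (elim exE conjE)
  obtain C2 where C2: "\<And>z j. z \<in> K \<Longrightarrow> norm ((deriv ^^ j) g z) / (h ^ j * W l2 j) \<le> C2"
    using bdd unfolding bdd_above_def by blast
  have g_bound: "norm ((deriv ^^ j) g z) \<le> C2 * (h ^ j * W l2 j)" if "z \<in> K" for z j
    using C2[OF that, of j] W_pos[of l2 j] l2 by (simp add: pos_divide_le_eq)
  obtain l1 c H where l1: "l1 > 0" "c \<ge> 1" "H \<ge> 1"
    and root: "\<And>N. \<exists>E>0. E ^ N = H ^ N * V l1 N \<and> (\<forall>j. 1 \<le> j \<longrightarrow> j \<le> Suc N \<longrightarrow> V l j \<le> c * E ^ (j - 1))"
    using M_rai_shifted_root[OF rai l(1)] by metis
  define l3 where "l3 = max l1 l2"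
  obtain l4 G where l4: "l4 > 0" "G \<ge> 1" "\<And>p q. V l3 p * V l3 q \<le> G ^ (p + q) * V l4 (p + q)"
    using M_rai_merge[OF rai, of l3] l1 by (metis l3_def less_max_iff_disj)
  \<comment> \<open>At least 1, so that its \<open>n\<close>-th power is at most its
    \<open>k\<close>-th power.\<close>
  define B where "B = max 1 (h * (C * c))"
  have gf_bound: "norm ((deriv ^^ k) (g \<circ> f) z) \<le> max 0 C2 * ((4 * B * H * G) ^ k * W l4 k)"
    if z: "z \<in> S" for z k
  proof -
    have fz: "f z \<in> K" using z closure_subset[of "f ` S"] unfolding K_def by blast
    have "C2 \<ge> 0"
      using order.trans[OF norm_ge_zero g_bound[OF fz, of 0]] by (simp add: W_0)
    let ?b = "fps_expansion f z - fps_const (f z)"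
    have term_le: "norm ((deriv ^^ n) g (f z) / fact n * (?b ^ n) $ k) \<le> C2 * ((2 * B * H * G) ^ k * V l4 k)"
      if n: "n \<in> {0..k}" for n
    proof -
      \<comment> \<open>The order left to the inner series: up to geometric factors
        \<open>E ^ (k - n)\<close> becomes \<open>V l1 N\<close>, which merges with the outer
        coefficient \<open>V l2 n\<close>.\<close>
      define N where "N = k - n"
      have N: "n + N = k" using n by (simp add: N_def)
      obtain E where E: "E > 0" "E ^ N = H ^ N * V l1 N"
          "\<And>j. 1 \<le> j \<Longrightarrow> j \<le> Suc N \<Longrightarrow> V l j \<le> c * E ^ (j - 1)"
        using root[of N] by blast
      have "norm ((?b ^ n) $ k) \<le> (C * c) ^ n * 2 ^ k * E ^ (k - n)"
      proof (rule fps_power_nth_bound[where N = N])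
        fix j :: nat
        assume j: "1 \<le> j" "j \<le> Suc N"
        have "norm (?b $ j) = norm ((deriv ^^ j) f z) / fact j"
          using j by (simp add: fps_nth_fps_expansion_at norm_divide)
        also have "\<dots> \<le> C * V l j"
          using C[OF z, of j] by (simp add: check_def divide_right_mono)
        also have "\<dots> \<le> C * (c * E ^ (j - 1))" using E(3)[OF j] l by (intro mult_left_mono) auto
        finally show "norm (?b $ j) \<le> C * c * E ^ (j - 1)" by (simp add: mult.assoc)
      qed (use n l l1 E in \<open>auto simp: fps_nth_fps_expansion_at N_def\<close>)
      also have "E ^ (k - n) = H ^ N * V l1 N" using E(2) by (simp add: N_def)
      finally have b: "norm ((?b ^ n) $ k) \<le> (C * c) ^ n * 2 ^ k * (H ^ N * V l1 N)" .
      have "norm ((deriv ^^ n) g (f z) / fact n) \<le> C2 * (h ^ n * V l2 n)"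
        using g_bound[OF fz, of n] by (simp add: norm_divide check_def divide_right_mono)
      then have "norm ((deriv ^^ n) g (f z) / fact n * (?b ^ n) $ k) \<le>
          (C2 * (h ^ n * V l2 n)) * ((C * c) ^ n * 2 ^ k * (H ^ N * V l1 N))"
        unfolding norm_mult using b \<open>C2 \<ge> 0\<close> l2 V_pos[of l2 n]
        by (intro mult_mono) auto
      also have "\<dots> = C2 * ((h * (C * c)) ^ n * 2 ^ k * H ^ N * (V l2 n * V l1 N))"
        by (simp add: power_mult_distrib)
      also have "\<dots> \<le> C2 * (B ^ k * 2 ^ k * H ^ k * (G ^ k * V l4 k))"
      proof -
        have "(h * (C * c)) ^ n \<le> B ^ n"
          using l2 l l1 by (intro power_mono) (auto simp: B_def)
        also have "\<dots> \<le> B ^ k" using n by (intro power_increasing) (auto simp: B_def)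
        finally have B: "(h * (C * c)) ^ n \<le> B ^ k" .
        have "H ^ N \<le> H ^ k" using N l1 by (intro power_increasing) auto
        then have BH: "(h * (C * c)) ^ n * 2 ^ k * H ^ N \<le> B ^ k * 2 ^ k * H ^ k"
          using B l1 by (intro mult_mono) (auto simp: B_def)
        have "V l2 n * V l1 N \<le> V l3 n * V l3 N"
          using l1 l2 V_pos by (intro mult_mono V_mono) (auto simp: l3_def intro: less_imp_le)
        also have "\<dots> \<le> G ^ k * V l4 k" using l4(3)[of n N] N by simp
        finally have "V l2 n * V l1 N \<le> G ^ k * V l4 k" .
        with BH have "(h * (C * c)) ^ n * 2 ^ k * H ^ N * (V l2 n * V l1 N) \<le>
            B ^ k * 2 ^ k * H ^ k * (G ^ k * V l4 k)"
          by (rule mult_mono) (use l1 V_pos[of l2 n] V_pos[of l1 N] in \<open>auto simp: B_def\<close>)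
        then show ?thesis using \<open>C2 \<ge> 0\<close> by (rule mult_left_mono)
      qed
      also have "\<dots> = C2 * ((2 * B * H * G) ^ k * V l4 k)" by (simp add: power_mult_distrib)
      finally show ?thesis .
    qed
    have "norm ((deriv ^^ k) (g \<circ> f) z / fact k) \<le> (\<Sum>n=0..k. C2 * ((2 * B * H * G) ^ k * V l4 k))"
    proof (subst higher_deriv_compose)
      show "f analytic_on {z}" using f_holo S z by (auto simp: analytic_at)
      show "g analytic_on {f z}"
        using g U fz by (auto simp: analytic_at local_class_def K_def)
    qed (rule sum_norm_le, rule term_le)
    also have "\<dots> = real (Suc k) * (C2 * ((2 * B * H * G) ^ k * V l4 k))" by simp
    \<comment> \<open>The number of terms is absorbed by doubling the base.\<close>
    also have "\<dots> \<le> 2 ^ k * (C2 * ((2 * B * H * G) ^ k * V l4 k))"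
    proof (rule mult_right_mono)
      have "Suc k \<le> 2 ^ k" by (simp add: Suc_leI)
      then show "real (Suc k) \<le> 2 ^ k" by (metis of_nat_le_iff of_nat_numeral of_nat_power)
    qed (use \<open>C2 \<ge> 0\<close> l1 l4 V_pos[of l4 k] in \<open>auto simp: B_def\<close>)
    also have "\<dots> = C2 * ((2 * (2 * B * H * G)) ^ k * V l4 k)"
      unfolding power_mult_distrib[of 2 "2 * B * H * G"] by (simp only: mult_ac)
    finally show ?thesis
      using \<open>C2 \<ge> 0\<close> by (simp add: check_def norm_divide divide_le_cancel mult.assoc)
  qed
  obtain l5 A where l5: "l5 > 0" "A > 0" "\<And>j. (4 * B * H * G) ^ j * W l4 j \<le> A * W l5 j"
    using W_absorb[OF l4(1), of "4 * B * H * G"] by blast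
  have "norm ((deriv ^^ k) (g \<circ> f) z) \<le> max 1 (max 0 C2 * A) * W l5 k" if "z \<in> S" for z k
  proof -
    have "norm ((deriv ^^ k) (g \<circ> f) z) \<le> max 0 C2 * (A * W l5 k)"
      using gf_bound[OF that, of k] mult_left_mono[OF l5(3)[of k], of "max 0 C2"] by simp
    also have "\<dots> = (max 0 C2 * A) * W l5 k" by simp
    also have "\<dots> \<le> max 1 (max 0 C2 * A) * W l5 k"
      using W_pos[of l5 k] by (intro mult_right_mono) auto
    finally show ?thesis .
  qed
  moreover have "g \<circ> f holomorphic_on S"
    using f_holo g U closure_subset[of "f ` S"]
    by (intro holomorphic_on_compose_gen[of f S g U]) (auto simp: local_class_def)
  ultimately show "g \<circ> f \<in> ultraholomorphic \<omega> S"
    unfolding ultraholomorphic_iff using l5(1) max.cobounded1[of 1 "max 0 C2 * A"] by blast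
qed

lemma M_rai_imp_holomorphically_closed:
  assumes "M_rai W" "open S"
  shows "holomorphically_closed \<omega> S"
proof -
  obtain l H where l: "l > 0" "H \<ge> 1" "\<And>k. fact k \<le> H ^ k * W l k"
    using M_rai_fact_le[OF assms(1)] by blast
  then have "g \<in> local_class W U" if "open U" "g holomorphic_on U" for g U
    using that by (intro holomorphic_imp_local_class[of l H 1]) auto
  then show ?thesis
    using M_rai_imp_composition_closed[OF assms]
    unfolding composition_closed_def holomorphically_closed_def by blast
qed

section \<open>Inverse-closedness as a special case\<close>

lemma closure_image_avoids_zero:
  fixes f :: "complex \<Rightarrow> complex"
  assumes "(INF z\<in>S. norm (f z)) > 0"
  shows "closure (f ` S) \<subseteq> - {0}"
proof -
  define d where "d = (INF z\<in>S. norm (f z))"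
  have "norm (f z) \<ge> d" if "z \<in> S" for z
    unfolding d_def using that by (intro cINF_lower bdd_belowI[of _ 0]) auto
  then have "closure (f ` S) \<subseteq> - ball 0 d"
    by (intro closure_minimal) (auto simp: image_subset_iff not_less)
  then show ?thesis using assms by (auto simp: d_def)
qed

lemma closed_imp_inverse_closed:
  assumes "\<And>f. f \<in> ultraholomorphic \<omega> S \<Longrightarrow> closure (f ` S) \<subseteq> - {0} \<Longrightarrow>
    (\<lambda>w. 1 / w) \<circ> f \<in> ultraholomorphic \<omega> S"
  shows "inverse_closed \<omega> S"
  using assms closure_image_avoids_zero unfolding inverse_closed_def o_def by blast

lemma holomorphically_closed_imp_inverse_closed:
  assumes "holomorphically_closed \<omega> S"
  shows "inverse_closed \<omega> S"
proof (rule closed_imp_inverse_closed)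
  fix f
  assume "f \<in> ultraholomorphic \<omega> S" "closure (f ` S) \<subseteq> - {0}"
  moreover have "open (- {0 :: complex})" "(\<lambda>w :: complex. 1 / w) holomorphic_on - {0}"
    by (auto intro!: holomorphic_intros)
  ultimately show "(\<lambda>w. 1 / w) \<circ> f \<in> ultraholomorphic \<omega> S"
    using assms unfolding holomorphically_closed_def by blast
qed

text \<open>Linear growth bounds \<open>j!\<close> by the weights up to geometric factors, which
  puts \<open>1 / w\<close> into the local class.\<close>

lemma composition_closed_imp_inverse_closed:
  assumes "\<omega> \<in> O[at_top](\<lambda>t. t)" "composition_closed \<omega> S"
  shows "inverse_closed \<omega> S"
proof (rule closed_imp_inverse_closed)
  fix f
  assume f: "f \<in> ultraholomorphic \<omega> S" "closure (f ` S) \<subseteq> - {0}"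
  obtain h where h: "h \<ge> 1" "\<And>j. fact j \<le> h * h ^ j * W 1 j"
    using linear_imp_fact_le[OF assms(1), of 1] by (metis zero_less_one)
  have "open (- {0 :: complex})" by auto
  moreover have "(\<lambda>w :: complex. 1 / w) \<in> local_class W (- {0})"
    using h by (intro holomorphic_imp_local_class[of 1 h h]) (auto intro!: holomorphic_intros)
  ultimately show "(\<lambda>w. 1 / w) \<circ> f \<in> ultraholomorphic \<omega> S"
    using assms(2) f unfolding composition_closed_def by blast
qed

text \<open>Log-convexity: \<open>ln (\<mu> j)\<close> is the slope of \<open>ln (W l n)\<close>
  between \<open>j\<close> and \<open>j + 1\<close>, and the line of this slope through the point at
  \<open>j\<close> is a supporting line. The powers are arranged to avoid negative
  exponents.\<close>

lemma W_tangent: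
  fixes \<mu> :: "nat \<Rightarrow> real"
  assumes l: "l > 0" and \<mu>: "\<And>j. \<mu> j = W l (Suc j) / W l j"
  shows "W l j * \<mu> j ^ n \<le> W l n * \<mu> j ^ j"
proof -
  have \<mu>_pos: "\<mu> j > 0" for j using W_pos by (simp add: \<mu>)
  have W_Suc: "W l (Suc j) = W l j * \<mu> j" for j using W_pos[of l j] by (simp add: \<mu>)
  have "\<mu> j \<le> \<mu> (Suc j)" for j
    using W_log_convex[OF l, of j] W_pos[of l j] W_pos[of l "Suc j"] by (simp add: \<mu> field_simps)
  then have \<mu>_mono: "i \<le> j \<Longrightarrow> \<mu> i \<le> \<mu> j" for i j by (rule lift_Suc_mono_le)
  have up: "W l j * \<mu> j ^ d \<le> W l (j + d)" for d
  proof (induction d)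
    case (Suc d)
    have "W l j * \<mu> j ^ Suc d = (W l j * \<mu> j ^ d) * \<mu> j" by simp
    also have "\<dots> \<le> W l (j + d) * \<mu> (j + d)"
      using Suc \<mu>_mono[of j "j + d"] \<mu>_pos[of j] W_pos[of l "j + d"] by (intro mult_mono) auto
    finally show ?case by (simp add: W_Suc)
  qed simp
  have down: "W l (n + d) \<le> W l n * \<mu> (n + d) ^ d" for d
  proof (induction d)
    case (Suc d)
    have "W l (n + Suc d) \<le> (W l n * \<mu> (n + d) ^ d) * \<mu> (n + d)"
      using Suc \<mu>_pos[of "n + d"] by (simp add: W_Suc)
    also have "\<dots> = W l n * \<mu> (n + d) ^ Suc d" by simp
    also have "\<dots> \<le> W l n * \<mu> (n + Suc d) ^ Suc d"
      using \<mu>_mono[of "n + d" "n + Suc d"] \<mu>_pos[of "n + d"] W_pos[of l n]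
      by (intro mult_left_mono power_mono) auto
    finally show ?case .
  qed simp
  show ?thesis
  proof (cases "j \<le> n")
    case True
    then have "W l j * \<mu> j ^ n = (W l j * \<mu> j ^ (n - j)) * \<mu> j ^ j"
      by (simp flip: power_add)
    also have "\<dots> \<le> W l n * \<mu> j ^ j"
      using up[of "n - j"] True \<mu>_pos[of j] by (intro mult_right_mono) auto
    finally show ?thesis .
  next
    case False
    then have "W l j * \<mu> j ^ n \<le> (W l n * \<mu> j ^ (j - n)) * \<mu> j ^ n"
      using down[of "j - n"] \<mu>_pos[of j] by (intro mult_right_mono) auto
    also have "\<dots> = W l n * \<mu> j ^ j" using False by (simp flip: power_add)
    finally show ?thesis .
  qed
qed

text \<open>Functions with derivatives of maximal size \<open>W l n\<close>: superpositions of the exponentials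
  \<open>exp (- \<mu>\<^sub>j z)\<close>, which are bounded in the right half-plane and whose derivatives at positive reals
  have alternating signs. The \<open>j\<close>-th term is normalised so that its \<open>j\<close>-th derivative at \<open>0\<close> is
  \<open>\<plusminus> W l j / 2\<^sup>j\<close>.\<close>

lemma extremal_functions:
  assumes l: "l > 0"
  obtains F :: "nat \<Rightarrow> complex \<Rightarrow> complex" and p :: "nat \<Rightarrow> real \<Rightarrow> real" where
    "\<And>n z. Re z > 0 \<Longrightarrow> (F n has_field_derivative F (Suc n) z) (at z)"
    "\<And>n z. Re z > 0 \<Longrightarrow> norm (F n z) \<le> 2 * W l n"
    "\<And>n x. x > 0 \<Longrightarrow> F n (of_real x) = of_real ((-1) ^ n * p n x)"
    "\<And>n x. x > 0 \<Longrightarrow> p n x \<ge> 0"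
    "\<And>n. \<exists>x>0. W l n / 2 ^ Suc n \<le> p n x"
proof -
  define \<mu> where "\<mu> j = W l (Suc j) / W l j" for j
  define a where "a j = (1 / 2) ^ j * (W l j / \<mu> j ^ j)" for j
  define e where "e n j z = complex_of_real (a j) * (- of_real (\<mu> j)) ^ n * exp (- of_real (\<mu> j) * z)" for n j z
  define F where "F n z = (\<Sum>j. e n j z)" for n z
  define r where "r n x j = a j * \<mu> j ^ n * exp (- \<mu> j * x)" for n x j
  define p where "p n x = (\<Sum>j. r n x j)" for n x
  have \<mu>_pos: "\<mu> j > 0" for j using W_pos by (simp add: \<mu>_def)
  have a_pos: "a j > 0" for j using W_pos \<mu>_pos by (simp add: a_def)
  \<comment> \<open>The tangent inequality controls the \<open>j\<close>-th term in all derivatives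
    at once; \<open>(1 / 2) ^ j\<close> makes the series converge.\<close>
  have a_le: "a j * \<mu> j ^ n \<le> (1 / 2) ^ j * W l n" for n j
  proof -
    have "W l j * \<mu> j ^ n / \<mu> j ^ j \<le> W l n"
      using W_tangent[OF l \<mu>_def, of j n] \<mu>_pos[of j] by (simp add: pos_divide_le_eq)
    then have "(1 / 2) ^ j * (W l j * \<mu> j ^ n / \<mu> j ^ j) \<le> (1 / 2) ^ j * W l n"
      by (intro mult_left_mono) auto
    then show ?thesis by (simp add: a_def)
  qed
  have e_bound: "norm (e n j z) \<le> (1 / 2) ^ j * W l n" if "Re z > 0" for n j z
  proof -
    have "norm (e n j z) = (a j * \<mu> j ^ n) * exp (- (\<mu> j * Re z))"
      using a_pos[of j] \<mu>_pos[of j] by (simp add: e_def norm_mult norm_power)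
    also have "\<dots> \<le> ((1 / 2) ^ j * W l n) * 1"
      using that a_pos[of j] \<mu>_pos[of j] W_pos[of l n] a_le
      by (intro mult_mono[of "a j * \<mu> j ^ n"]) auto
    finally show ?thesis by simp
  qed
  have geometric: "(\<lambda>j. (1 / 2) ^ j * W l n) sums (2 * W l n)" for n
    using sums_mult2[OF geometric_sums[of "1 / 2 :: real"], of "W l n"] by simp
  have F_deriv: "(F n has_field_derivative F (Suc n) z) (at z)" if z: "Re z > 0" for n z
  proof -
    have P: "open {z. Re z > 0}" by (rule open_halfspace_Re_gt)
    have e_deriv: "(e n j has_field_derivative e (Suc n) j z) (at z)" for j z
      unfolding e_def by (auto intro!: derivative_eq_intros)
    have "\<exists>g g'. \<forall>z\<in>{z. Re z > 0}. ((\<lambda>j. e n j z) sums g z) \<and>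
        ((\<lambda>j. e (Suc n) j z) sums g' z) \<and> (g has_field_derivative g' z) (at z)"
    proof (rule series_and_derivative_comparison[OF P sums_summable[OF geometric[of n]],
          of "e n" "e (Suc n)"])
      show "\<forall>\<^sub>F j in sequentially. \<forall>z\<in>{z. Re z > 0}. norm (e n j z) \<le> (1 / 2) ^ j * W l n"
        using e_bound by simp
    qed (use e_deriv in blast)+
    then obtain g g' where g: "\<And>z. Re z > 0 \<Longrightarrow> (\<lambda>j. e n j z) sums g z"
        "\<And>z. Re z > 0 \<Longrightarrow> (\<lambda>j. e (Suc n) j z) sums g' z"
        "\<And>z. Re z > 0 \<Longrightarrow> (g has_field_derivative g' z) (at z)"
      by auto
    have "(g has_field_derivative F (Suc n) z) (at z)"
      using g(3)[OF z] sums_unique[OF g(2)[OF z]] by (simp add: F_def)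
    then show ?thesis
      by (rule has_field_derivative_transform_within_open[OF _ P])
         (use z sums_unique[OF g(1)] in \<open>simp_all add: F_def\<close>)
  qed
  have F_bound: "norm (F n z) \<le> 2 * W l n" if z: "Re z > 0" for n z
    unfolding F_def sums_unique[OF geometric[of n]]
    using e_bound[OF z] by (rule norm_suminf_le) (rule sums_summable[OF geometric])
  have r_nonneg: "r n x j \<ge> 0" for n x j
    using a_pos[of j] \<mu>_pos[of j] by (simp add: r_def)
  have e_r: "e n j (of_real x) = of_real ((-1) ^ n * r n x j)" for n j x
    by (simp add: e_def r_def exp_of_real power_minus[of "complex_of_real (\<mu> j)"] flip: exp_of_real)
  have r_summable: "summable (r n x)" if "x > 0" for n x
  proof (rule summable_comparison_test[OF _ sums_summable[OF geometric[of n]]])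
    have "norm (r n x j) \<le> (1 / 2) ^ j * W l n" for j
      using e_bound[of "of_real x" n j] that by (simp add: e_r norm_mult norm_power del: of_real_mult)
        (simp add: abs_mult power_abs)
    then show "\<exists>N. \<forall>j\<ge>N. norm (r n x j) \<le> (1 / 2) ^ j * W l n" by blast
  qed
  have F_real: "F n (of_real x) = of_real ((-1) ^ n * p n x)" if x: "x > 0" for n x
    unfolding F_def p_def e_r using r_summable[OF x, of n]
    by (simp add: suminf_of_real[symmetric] suminf_mult summable_mult del: of_real_mult)
  have p_nonneg: "p n x \<ge> 0" if x: "x > 0" for n x
    unfolding p_def using r_nonneg r_summable[OF x] by (intro suminf_nonneg) auto
  have p_large: "\<exists>x>0. W l n / 2 ^ Suc n \<le> p n x" for n
  proof (intro exI conjI)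
    \<comment> \<open>The point 0 itself is excluded; here the exponential factor of the
      \<open>n\<close>-th term is \<open>1 / 2\<close>, whence the exponent
      \<open>Suc n\<close>.\<close>
    let ?x = "ln 2 / \<mu> n"
    show x: "?x > 0" using \<mu>_pos by simp
    have "W l n / 2 ^ Suc n = r n ?x n"
      using \<mu>_pos[of n] by (simp add: r_def a_def exp_minus power_divide field_simps)
    also have "\<dots> \<le> p n ?x"
      unfolding p_def using sum_le_suminf[OF r_summable[OF x], of "{n}" n] r_nonneg by simp
    finally show "W l n / 2 ^ Suc n \<le> p n ?x" .
  qed
  show thesis using that[OF F_deriv F_bound F_real p_nonneg p_large] by blast
qed

text \<open>The parameter \<open>l'\<close> and the constant \<open>C\<close> obtained for the
  reciprocal hold on the whole sector, so the positive real \<open>x\<close> at which coefficients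
  are compared may be chosen for each \<open>j\<close> separately.\<close>

lemma inverse_closed_imp_M_rai:
  assumes inv: "inverse_closed \<omega> (sector \<alpha>)" and \<alpha>: "0 < \<alpha>" "\<alpha> \<le> 1"
  shows "M_rai W"
proof (rule M_rai_if_multiples)
  fix l :: real
  assume l: "l > 0"
  obtain F :: "nat \<Rightarrow> complex \<Rightarrow> complex" and p :: "nat \<Rightarrow> real \<Rightarrow> real" where
    F_deriv: "\<And>n z. Re z > 0 \<Longrightarrow> (F n has_field_derivative F (Suc n) z) (at z)" and
    F_bound: "\<And>n z. Re z > 0 \<Longrightarrow> norm (F n z) \<le> 2 * W l n" and
    F_real: "\<And>n x. x > 0 \<Longrightarrow> F n (of_real x) = of_real ((-1) ^ n * p n x)" and
    p_nonneg: "\<And>n x. x > 0 \<Longrightarrow> p n x \<ge> 0" and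
    p_large: "\<And>n. \<exists>x>0. W l n / 2 ^ Suc n \<le> p n x"
    using extremal_functions[OF l] by blast
  have sub: "Re z > 0" if "z \<in> sector \<alpha>" for z
    using sector_subset_Re_pos[OF \<alpha>(2)] that by blast
  \<comment> \<open>As \<open>norm (F 0 z) \<le> 2\<close>, the constant 3 keeps
    \<open>norm (G 0 z) \<ge> 1\<close> and the later \<open>c\<close> between 1 and 3.\<close>
  define G where "G n z = (if n = 0 then 3 else 0) - F n z" for n z
  have G_deriv: "(G n has_field_derivative G (Suc n) z) (at z)" if "z \<in> {z. Re z > 0}" for n z
    unfolding G_def using that by (auto intro!: derivative_eq_intros F_deriv)
  have G_higher: "(deriv ^^ n) (G 0) z = G n z" if "Re z > 0" for n z
    using higher_deriv_eqI[where S = "{z. Re z > 0}" and F = G] open_halfspace_Re_gt G_deriv that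
    by blast
  have G_holo: "G 0 holomorphic_on {z. Re z > 0}"
    using G_deriv open_halfspace_Re_gt holomorphic_on_open by blast
  have F0: "norm (F 0 z) \<le> 2" if "Re z > 0" for z
    using F_bound[OF that, of 0] by (simp add: W_0)
  have G0: "norm (G 0 z) \<ge> 1" if "Re z > 0" for z
    using F0[OF that] norm_triangle_ineq2[of 3 "F 0 z"] by (simp add: G_def)
  have "norm ((deriv ^^ j) (G 0) z) \<le> 5 * W l j" if "z \<in> sector \<alpha>" for z j
  proof -
    have z: "Re z > 0" using that by (rule sub)
    have "norm (G j z) \<le> 3 + norm (F j z)"
      using norm_triangle_ineq4[of "if j = 0 then 3 else 0" "F j z"] by (auto simp: G_def split: if_splits)
    then show ?thesis
      using F_bound[OF z, of j] W_ge_1[OF l, of j] G_higher[OF z, of j] by simp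
  qed
  moreover have "G 0 holomorphic_on sector \<alpha>"
    using G_holo sector_subset_Re_pos[OF \<alpha>(2)] by (rule holomorphic_on_subset)
  moreover have "(1 :: real) \<le> 5" by simp
  ultimately have "G 0 \<in> ultraholomorphic \<omega> (sector \<alpha>)"
    unfolding ultraholomorphic_iff using l by blast
  moreover have "(INF z\<in>sector \<alpha>. norm (G 0 z)) \<ge> 1"
    using of_real_in_sector[OF \<alpha>(1), of 1] G0 sub by (intro cINF_greatest) auto
  ultimately have "(\<lambda>z. 1 / G 0 z) \<in> ultraholomorphic \<omega> (sector \<alpha>)"
    using inv unfolding inverse_closed_def by fastforce
  then obtain l' C where l': "l' > 0" "C \<ge> 1"
    and C: "\<And>z j. z \<in> sector \<alpha> \<Longrightarrow> norm ((deriv ^^ j) (\<lambda>z. 1 / G 0 z) z) \<le> C * W l' j"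
    unfolding ultraholomorphic_iff by blast
  have "V l j ^ m \<le> (36 * C) ^ (j * m) * V l' (j * m)" if jm: "1 \<le> j" "1 \<le> m" for j m
  proof -
    obtain x where x: "x > 0" "W l j / 2 ^ Suc j \<le> p j x" using p_large by blast
    define z where "z = complex_of_real x"
    have z: "Re z > 0" using x by (simp add: z_def)
    define c where "c = 3 - p 0 x"
    have c: "1 \<le> c" "c \<le> 3"
      using F0[OF z] F_real[OF x(1), of 0] p_nonneg[OF x(1), of 0] by (simp_all add: c_def z_def)
    have G_an: "G 0 analytic_on {z}"
      using G_holo open_halfspace_Re_gt[of 0] z by (auto simp: analytic_at)
    let ?G = "fps_expansion (G 0) z"
    have G_nth: "?G $ i = G i z / fact i" for i
      using G_higher[OF z] by (simp add: fps_nth_fps_expansion_at)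
    have G_0: "?G $ 0 \<noteq> 0" using G0[OF z] by (auto simp: G_nth)
    have "(\<lambda>u. inverse (G 0 (z + u))) has_fps_expansion inverse ?G"
      by (intro has_fps_expansion_inverse analytic_at_imp_has_fps_expansion G_an G_0)
    then have "inverse ?G $ n = (deriv ^^ n) (\<lambda>u. inverse (G 0 (z + u))) 0 / fact n" for n
      by (rule fps_nth_fps_expansion)
    moreover have "(deriv ^^ n) (\<lambda>u. inverse (G 0 (z + u))) 0 = (deriv ^^ n) (\<lambda>z. 1 / G 0 z) z" for n
      using higher_deriv_shift_0'[where f = "\<lambda>z. 1 / G 0 z" and z = z and n = n] by (simp add: o_def inverse_eq_divide)
    ultimately have H_nth: "inverse ?G $ n = (deriv ^^ n) (\<lambda>z. 1 / G 0 z) z / fact n" for n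
      by simp
    \<comment> \<open>The signs are those of the reflection about \<open>x\<close>: \<open>q\<close>
      and \<open>s\<close> are the coefficients of \<open>1 / G 0\<close> and \<open>G 0\<close> in
      the reflected variable, and \<open>s\<close> is nonpositive beyond its constant term.\<close>
    define q where "q n = Re ((-1) ^ n * inverse ?G $ n)" for n
    define s where "s i = (if i = 0 then c else - (p i x / fact i))" for i
    have s: "(-1) ^ i * ?G $ i = of_real (s i)" for i
      unfolding G_nth using F_real[OF x(1), of i] by (auto simp: G_def s_def c_def z_def)
    \<comment> \<open>The \<open>n\<close>-th coefficient of
      \<open>G 0 * (1 / G 0) = 1\<close>.\<close>
    have recursion: "(\<Sum>i=0..n. s i * q (n - i)) = (if n = 0 then 1 else 0)" for n
    proof -
      have "(?G * inverse ?G) $ n = (if n = 0 then 1 else 0)"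
        using inverse_mult_eq_1'[OF G_0] by simp
      then have "(-1) ^ n * (\<Sum>i=0..n. ?G $ i * inverse ?G $ (n - i)) = (if n = 0 then 1 else 0)"
        by (simp add: fps_mult_nth)
      also have "(-1) ^ n * (\<Sum>i=0..n. ?G $ i * inverse ?G $ (n - i)) =
          (\<Sum>i=0..n. of_real (s i) * ((-1) ^ (n - i) * inverse ?G $ (n - i)))"
        unfolding sum_distrib_left
      proof (rule sum.cong)
        fix i
        assume "i \<in> {0..n}"
        then have "(-1 :: complex) ^ n = (-1) ^ i * (-1) ^ (n - i)" by (simp flip: power_add)
        then show "(-1) ^ n * (?G $ i * inverse ?G $ (n - i)) =
            of_real (s i) * ((-1) ^ (n - i) * inverse ?G $ (n - i))"
          unfolding s[symmetric] by (simp add: mult_ac)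
      qed simp
      finally have "Re (\<Sum>i=0..n. of_real (s i) * ((-1) ^ (n - i) * inverse ?G $ (n - i))) =
          (if n = 0 then 1 else 0)" by simp
      moreover have "Re (of_real a * b) = a * Re b" for a b by simp
      ultimately show ?thesis by (simp only: Re_sum q_def)
    qed
    have "(p j x / fact j / c) ^ m / c \<le> q (j * m)"
    proof (rule reciprocal_coeff_ge[where p = "\<lambda>i. p i x / fact i"])
      show "c * q 0 = 1" using recursion[of 0] by (simp add: s_def)
      fix n :: nat
      assume "n \<ge> 1"
      then have "c * q n + (\<Sum>i=1..n. s i * q (n - i)) = 0"
        using recursion[of n] by (simp add: sum.atLeast_Suc_atMost s_def)
      moreover have "(\<Sum>i=1..n. s i * q (n - i)) = - (\<Sum>i=1..n. p i x / fact i * q (n - i))"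
        unfolding sum_negf[symmetric] by (intro sum.cong) (auto simp: s_def)
      ultimately show "c * q n = (\<Sum>i=1..n. p i x / fact i * q (n - i))" by simp
    qed (use c p_nonneg[OF x(1)] jm in auto)
    also have "q (j * m) \<le> norm (inverse ?G $ (j * m))"
      unfolding q_def using complex_Re_le_cmod[of "(-1) ^ (j * m) * inverse ?G $ (j * m)"]
      by (simp add: norm_mult norm_power)
    also have "\<dots> \<le> C * V l' (j * m)"
      unfolding H_nth using C[OF of_real_in_sector[OF \<alpha>(1) x(1)], of "j * m"]
      by (simp add: z_def norm_divide check_def divide_right_mono)
    finally have upper: "(p j x / fact j / c) ^ m / c \<le> C * V l' (j * m)" .
    have "(V l j / (2 ^ Suc j * 3)) ^ m / 3 \<le> (p j x / fact j / c) ^ m / c"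
    proof -
      have "V l j / (2 ^ Suc j * 3) = W l j / 2 ^ Suc j / fact j / 3" by (simp add: check_def)
      also have "\<dots> \<le> p j x / fact j / c"
        using x c p_nonneg[OF x(1), of j] by (intro frac_le divide_right_mono) auto
      finally have "(V l j / (2 ^ Suc j * 3)) ^ m \<le> (p j x / fact j / c) ^ m"
        using V_pos[of l j] by (intro power_mono) auto
      then show ?thesis
        using c p_nonneg[OF x(1), of j] by (intro frac_le) auto
    qed
    also note upper
    finally have "V l j ^ m \<le> 3 * C * (2 ^ Suc j * 3) ^ m * V l' (j * m)"
      by (simp add: power_divide field_simps)
    also have "\<dots> \<le> (3 ^ (j * m) * C ^ (j * m) * 12 ^ (j * m)) * V l' (j * m)"
    proof (intro mult_right_mono mult_mono)
      have 1: "1 \<le> j * m" using jm by simp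
      show "3 \<le> (3 :: real) ^ (j * m)" using power_increasing[OF 1, of "3 :: real"] by simp
      show "C \<le> C ^ (j * m)" using power_increasing[OF 1, of C] l' by simp
      \<comment> \<open>For \<open>j \<ge> 1\<close> the left side is at most
        \<open>4^j * 3^j\<close>; with the factors 3 and \<open>C\<close> this gives the base
        \<open>36 * C\<close>.\<close>
      have "(2 ^ Suc j * 3 :: real) \<le> 2 ^ (j + j) * 3 ^ j"
        using jm power_increasing[of 1 j "3 :: real"] by (intro mult_mono power_increasing) auto
      also have "\<dots> = 12 ^ j" by (simp add: power_add flip: power_mult_distrib)
      finally show "(2 ^ Suc j * 3 :: real) ^ m \<le> 12 ^ (j * m)"
        unfolding power_mult by (intro power_mono) auto
    qed (use l' V_pos[of l' "j * m"] in auto)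
    also have "\<dots> = (3 * C * 12) ^ (j * m) * V l' (j * m)"
      by (simp only: power_mult_distrib)
    finally show ?thesis by simp
  qed
  then show "\<exists>l'>0. \<exists>D\<ge>1. \<forall>j m. 1 \<le> j \<longrightarrow> 1 \<le> m \<longrightarrow> V l j ^ m \<le> D ^ (j * m) * V l' (j * m)"
    using l' by (intro exI[of _ l'] conjI exI[of _ "36 * C"]) auto
qed

end

theorem theorem6p2:
  fixes \<omega> :: "real \<Rightarrow> real" and \<alpha> :: real
  assumes "\<omega> \<in> weight_functions" and "0 < \<alpha>" and "\<alpha> \<le> 1"
  shows "(M_rai (weight_matrix \<omega>) \<longleftrightarrow> alpha0 \<omega>) \<and>
    (M_rai (weight_matrix \<omega>) \<longleftrightarrow> holomorphically_closed \<omega> (sector \<alpha>)) \<and>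
    (M_rai (weight_matrix \<omega>) \<longleftrightarrow> inverse_closed \<omega> (sector \<alpha>)) \<and>
    (\<omega> \<in> O[at_top](\<lambda>t. t) \<longrightarrow>
      (M_rai (weight_matrix \<omega>) \<longleftrightarrow> composition_closed \<omega> (sector \<alpha>)) \<and>
      (M_rai (weight_matrix \<omega>) \<longleftrightarrow> M_FdB (weight_matrix \<omega>)))"
proof -
  interpret weight_function \<omega> by unfold_locales (rule assms(1))
  show ?thesis
    using alpha0_imp_M_rai M_rai_imp_alpha0
      M_rai_imp_holomorphically_closed[OF _ open_sector[OF assms(3)]]
      holomorphically_closed_imp_inverse_closed inverse_closed_imp_M_rai[OF _ assms(2,3)]
      M_rai_imp_composition_closed[OF _ open_sector[OF assms(3)]]
      composition_closed_imp_inverse_closed M_rai_imp_M_FdB M_FdB_imp_M_rai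
    by blast
qed

end
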